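(* Let $\lambda_n$ ($n<\omega$) be regular or finite cardinals with $2^{\lambda_n}<\lambda_{n+1}$ for all $n$, and let $\lambda=\sum_{n<\omega}\lambda_n\ (\geq\aleph_0)$. Let $\mu_n$ ($n<\omega$) be cardinals with $\lambda=\sum_{n<\omega}\mu_n$, $\mu_{n+1}\geq\lambda_n$ and $\beth_3(\mu_n)<\lambda_n$ for all $n$. Let $\mu$ be a cardinal with $\lambda\leq\mu<\lambda^{\aleph_0}\ (=2^\lambda)$ such that $\mathrm{cov}(\mu,\lambda_n^+,\lambda_n^+,\mu_n^+)\leq\mu$ for every $n<\omega$. Let $T$ be the family of open subsets of a topological space $\Omega$ (not necessarily Hausdorff or even $T_0$), and suppose $T$ has a base $B$ of cardinality $\leq\mu$ (i.e. $B\subseteq T$ is closed under finite intersections and every member of $T$ is a union of a subfamily of $B$). Then: (1) either $|T|\geq\lambda^{\aleph_0}\ (=2^\lambda)$ or $|T|\leq\mu$; (2) in fact, if $|T|>\mu$ then there is a set $X_0\subseteq\Omega$ of $\lambda$ points such that $\{U\cap X_0: U\in T\}$ has cardinality $2^\lambda$; moreover there is $B'\subseteq T$ of cardinality $\lambda$ such that $\{X_0\cap U: U \text{ is the union of a subfamily of } B'\}$ has cardinality $2^\lambda$.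
   Context: $\beth_3(\kappa)=2^{2^{2^\kappa}}$. For cardinals $\mu,\lambda,\kappa$, $\mathrm{cov}(\mu,\lambda^+,\lambda^+,\kappa)$ is the minimal cardinality of a family $P$ of subsets of $\mu$, each of cardinality $\leq\lambda$, such that for every $a\subseteq\mu$ with $|a|\leq\lambda$ there are $\alpha<\kappa$ and $a_i\in P$ ($i<\alpha$) with $a\subseteq\bigcup_{i<\alpha}a_i$. *)

theory Defs
  imports "HOL-Analysis.Analysis"
begin

unbundle cardinal_syntax

definition beth3 :: "'a rel \<Rightarrow> (((('a \<Rightarrow> bool) \<Rightarrow> bool) \<Rightarrow> bool)) rel" where
  "beth3 r = ctwo ^c (ctwo ^c (ctwo ^c r))"

text \<open>
  The families \<open>P\<close> admitted in the definition of \<open>cov(\<mu>, \<nu>\<^sup>+, \<nu>\<^sup>+, \<kappa>)\<close>. The ordinals below \<open>\<kappa>\<close>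
  are the elements \<open>\<alpha>\<close> of \<open>Field \<kappa>\<close>, and the ordinals below \<open>\<alpha>\<close> form \<open>underS \<kappa> \<alpha>\<close>.
\<close>

definition cov_family :: "'a rel \<Rightarrow> 'b rel \<Rightarrow> 'c rel \<Rightarrow> 'a set set \<Rightarrow> bool" where
  "cov_family \<mu> \<nu> \<kappa> P \<longleftrightarrow>
     (\<forall>a\<in>P. a \<subseteq> Field \<mu> \<and> |a| \<le>o \<nu>) \<and>
     (\<forall>a. a \<subseteq> Field \<mu> \<and> |a| \<le>o \<nu> \<longrightarrow>
        (\<exists>\<alpha>\<in>Field \<kappa>. \<exists>f. (\<forall>i\<in>underS \<kappa> \<alpha>. f i \<in> P) \<and> a \<subseteq> (\<Union>i\<in>underS \<kappa> \<alpha>. f i)))"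

text \<open>
  \<open>cov \<mu> \<nu> \<kappa>\<close> is \<open>cov(\<mu>, \<nu>\<^sup>+, \<nu>\<^sup>+, \<kappa>)\<close>. If there is no admissible family (which can happen when
  \<open>\<kappa> \<le> 1\<close>), the minimum is by convention the cardinal of the whole type \<open>'a set\<close>. It exceeds
  \<open>\<mu>\<close>, so that \<open>cov \<mu> \<nu> \<kappa> \<le>o \<mu>\<close> then fails.
\<close>

definition cov :: "'a rel \<Rightarrow> 'b rel \<Rightarrow> 'c rel \<Rightarrow> 'a set rel" where
  "cov \<mu> \<nu> \<kappa> =
     (if \<exists>P. cov_family \<mu> \<nu> \<kappa> P
      then |SOME P. cov_family \<mu> \<nu> \<kappa> P \<and> (\<forall>P'. cov_family \<mu> \<nu> \<kappa> P' \<longrightarrow> |P| \<le>o |P'| )|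
      else |UNIV :: 'a set set| )"

lemma cov_minimum:
  assumes "cov_family \<mu> \<nu> \<kappa> Q"
  obtains P where "cov_family \<mu> \<nu> \<kappa> P" and "cov \<mu> \<nu> \<kappa> = |P|"
    and "\<And>P'. cov_family \<mu> \<nu> \<kappa> P' \<Longrightarrow> cov \<mu> \<nu> \<kappa> \<le>o |P'|"
proof -
  let ?m = "\<lambda>P. cov_family \<mu> \<nu> \<kappa> P \<and> (\<forall>P'. cov_family \<mu> \<nu> \<kappa> P' \<longrightarrow> |P| \<le>o |P'| )"
  let ?R = "card_of ` {P. cov_family \<mu> \<nu> \<kappa> P}"
  have "?R \<noteq> {}" using assms by blast
  moreover have "\<forall>r\<in>?R. Card_order r" by (auto simp: card_of_Card_order)
  ultimately obtain r where "r \<in> ?R" "\<forall>r'\<in>?R. r \<le>o r'"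
    using exists_minim_Card_order[of ?R] by blast
  then have "\<exists>P. ?m P" by auto
  then have m: "?m (SOME P. ?m P)" by (rule someI_ex)
  have cov: "cov \<mu> \<nu> \<kappa> = |SOME P. ?m P|"
    unfolding cov_def by (rule if_P) (rule exI, rule assms)
  show thesis
  proof (rule that)
    show "cov_family \<mu> \<nu> \<kappa> (SOME P. ?m P)" using m by (rule conjunct1)
    show "cov \<mu> \<nu> \<kappa> = |SOME P. ?m P|" by (rule cov)
    show "cov \<mu> \<nu> \<kappa> \<le>o |P'|" if "cov_family \<mu> \<nu> \<kappa> P'" for P'
      unfolding cov using m that by blast
  qed
qed

lemma cov_le_iff:
  assumes "Card_order \<mu>"
  shows "cov \<mu> \<nu> \<kappa> \<le>o \<mu> \<longleftrightarrow> (\<exists>P. cov_family \<mu> \<nu> \<kappa> P \<and> |P| \<le>o \<mu>)"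
proof (cases "\<exists>P. cov_family \<mu> \<nu> \<kappa> P")
  case True
  then obtain Q where "cov_family \<mu> \<nu> \<kappa> Q" by blast
  then obtain P where P: "cov_family \<mu> \<nu> \<kappa> P" "cov \<mu> \<nu> \<kappa> = |P|"
    "\<And>P'. cov_family \<mu> \<nu> \<kappa> P' \<Longrightarrow> cov \<mu> \<nu> \<kappa> \<le>o |P'|"
    by (rule cov_minimum) blast
  show ?thesis
  proof
    assume "cov \<mu> \<nu> \<kappa> \<le>o \<mu>"
    with P(1) show "\<exists>P. cov_family \<mu> \<nu> \<kappa> P \<and> |P| \<le>o \<mu>" unfolding P(2) by blast
  next
    assume "\<exists>P. cov_family \<mu> \<nu> \<kappa> P \<and> |P| \<le>o \<mu>"
    then obtain P' where P': "cov_family \<mu> \<nu> \<kappa> P'" "|P'| \<le>o \<mu>" by blast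
    show "cov \<mu> \<nu> \<kappa> \<le>o \<mu>" by (rule ordLeq_transitive[OF P(3)[OF P'(1)] P'(2)])
  qed
next
  case False
  have "|Field \<mu>| \<le>o |UNIV :: 'a set|" by (simp add: card_of_mono1)
  also have "|UNIV :: 'a set| <o |UNIV :: 'a set set|" using card_of_Pow[of "UNIV :: 'a set"] by (simp only: Pow_UNIV)
  finally have "|Field \<mu>| <o |UNIV :: 'a set set|" .
  moreover have "|Field \<mu>| =o \<mu>" using assms by (rule card_of_Field_ordIso)
  ultimately have "\<mu> <o |UNIV :: 'a set set|"
    using ordIso_ordLess_trans ordIso_symmetric by blast
  then have "\<not> cov \<mu> \<nu> \<kappa> \<le>o \<mu>"
    unfolding cov_def if_not_P[OF False] by (rule not_ordLess_ordLeq)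
  with False show ?thesis by blast
qed

text \<open>
  A base closed under finite intersections. Only intersections of nonempty finite subfamilies
  are considered, so the whole space need not belong to \<open>B\<close>.
\<close>

definition base_of :: "'a topology \<Rightarrow> 'a set set \<Rightarrow> bool" where
  "base_of X B \<longleftrightarrow>
     B \<subseteq> {U. openin X U} \<and>
     (\<forall>F. F \<subseteq> B \<and> finite F \<and> F \<noteq> {} \<longrightarrow> \<Inter>F \<in> B) \<and>
     (\<forall>U. openin X U \<longrightarrow> (\<exists>F\<subseteq>B. U = \<Union>F))"

end

theory Submission
  imports Defs
begin

text \<open>
  Call a family of open sets small if it has at most \<open>\<mu>\<close> members. A pair \<open>(Y, V)\<close> with \<open>V\<close> open
  prescribes the trace \<open>V \<inter> Y\<close> on \<open>Y\<close> of the open sets that contain \<open>V\<close>. If the family of these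
  sets is not small, then it has, for each \<open>n\<close>, \<open>\<mu>\<^sub>n\<close> many such subfamilies that are not small and are
  pairwise separated by points (two of them if all \<open>\<lambda>\<^sub>n\<close> are finite). Iterating this along a tree
  of height \<open>\<omega>\<close> and taking unions along the branches yields \<open>\<Prod>\<^sub>n \<mu>\<^sub>n = 2\<^sup>\<lambda>\<close> open sets that already
  differ on the \<open>\<lambda>\<close> separating points.

  For the splitting step there are two cases. If some family that is not small cannot be split by a
  single point into two such families, its members below the union form an ideal with small
  lower sets, and traces on a member of this ideal do the job. Otherwise one builds a binary tree of
  splitting points of height \<open>\<lambda>\<^sub>n\<close>. It has at most \<open>\<mu>\<close> nodes because
  the power set of \<open>\<lambda>\<^sub>n\<close> has size below \<open>\<lambda>\<close>, so some branch avoids all small nodes. The covering hypothesis and the Erdos--Rado theorem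
  then turn a branch into \<open>\<mu>\<^sub>n\<close> many separated families.
\<close>

subsection \<open>Cardinal arithmetic\<close>

lemma strict_well_order:
  obtains R where "wf R" "trans R" "total_on A R" "R \<subseteq> A \<times> A"
proof (rule that[of "|A| - Id"])
  have w: "well_order_on A |A|" by (rule card_of_well_order_on)
  then show "wf ( |A| - Id)" by (simp add: well_order_on_def)
  from w have p: "trans |A|" "antisym |A|" "total_on A |A|"
    by (auto simp: order_on_defs)
  from p(1,2) show "trans ( |A| - Id)" by (rule trans_diff_Id)
  from p(3) show "total_on A ( |A| - Id)" by (auto simp: total_on_def)
  show "|A| - Id \<subseteq> A \<times> A" using Field_card_of[of A] by (auto simp: Field_def)
qed

text \<open>The step \<open>S\<close> sees only the set of earlier values, not the earlier function.
  All transfinite constructions below have this shape: each new point or set depends only on the set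
  of those already chosen.\<close>

lemma wf_image_recursion:
  assumes "wf R"
  obtains f where "\<And>k. f k = S (f ` {j. (j, k) \<in> R})"
proof
  let ?F = "\<lambda>f k. S (f ` {j. (j, k) \<in> R})"
  fix k
  have "wfrec R ?F k = ?F (cut (wfrec R ?F) R k) k" by (rule wfrec[OF assms])
  also have "cut (wfrec R ?F) R k ` {j. (j, k) \<in> R} = wfrec R ?F ` {j. (j, k) \<in> R}"
    by (rule image_cong) (auto simp: cut_apply)
  finally show "wfrec R ?F k = S (wfrec R ?F ` {j. (j, k) \<in> R})" .
qed

lemma card_of_ordLeq_not: "\<not> |A| \<le>o |B| \<longleftrightarrow> |B| <o |A|"
  by (simp add: not_ordLeq_iff_ordLess card_of_Well_order)

lemma card_of_self_Pow: "|A| \<le>o |Pow A|"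
  by (rule ordLess_imp_ordLeq[OF card_of_Pow])

lemma card_of_Pow_mono: "|A| \<le>o |B| \<Longrightarrow> |Pow A| \<le>o |Pow B|"
proof -
  assume "|A| \<le>o |B|"
  then obtain f where "inj_on f A" "f ` A \<subseteq> B" unfolding card_of_ordLeq[symmetric] by blast
  then have "inj_on (image f) (Pow A)" "image f ` Pow A \<subseteq> Pow B"
    by (auto intro: inj_on_image_Pow)
  then show ?thesis unfolding card_of_ordLeq[symmetric] by blast
qed

text \<open>
  The Erdos--Rado argument: every point z determines a sequence of pairwise distinct points in which
  each earlier point has the same colour towards all later ones and towards z. A sequence
  that reaches z is determined by its length and its colours, which leaves too few
  possibilities for all z.
\<close>

lemma homogeneous_subset:
  assumes K: "infinite K" and A: "|Pow (Pow K)| <o |A|"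
    and col: "\<And>x y. x \<in> A \<Longrightarrow> y \<in> A \<Longrightarrow> x \<noteq> y \<Longrightarrow> f x y \<in> K"
  obtains H i where "H \<subseteq> A" "|K| \<le>o |H|" "i \<in> K"
    "\<And>x y. x \<in> H \<Longrightarrow> y \<in> H \<Longrightarrow> x \<noteq> y \<Longrightarrow> f x y = i \<or> f y x = i"
proof -
  \<comment> \<open>The sequences are indexed by a well-order on \<open>Pow K\<close>: long enough
    for a pigeonhole over the colours in \<open>K\<close>, short enough to leave at most
    \<open>|Pow (Pow K)|\<close> codes.\<close>
  define N where "N = Pow K"
  obtain R where R: "wf R" "trans R" "total_on N R" "R \<subseteq> N \<times> N" by (rule strict_well_order)
  define step where "step z X = (SOME y. y \<in> A \<and> (\<forall>x\<in>X. y \<noteq> x \<and> f x y = f x z))" for z X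
  have "\<forall>z. \<exists>g. \<forall>k. g k = step z (g ` {j. (j, k) \<in> R})"
    by (metis wf_image_recursion[OF R(1)])
  then obtain g where g: "\<And>z k. g z k = step z (g z ` {j. (j, k) \<in> R})" by metis
  define Q where "Q z k y \<longleftrightarrow> y \<in> A \<and> (\<forall>j. (j, k) \<in> R \<longrightarrow> y \<noteq> g z j \<and> f (g z j) y = f (g z j) z)" for z k y
  have gQ: "g z k = (SOME y. Q z k y)" for z k
    by (subst g) (simp add: step_def Q_def[abs_def])
  have infN: "infinite N" using K by (simp add: N_def)
  \<comment> \<open>Bounds the number of codes, a code being the position at which \<open>z\<close>
    is first reached together with the graph of the colours before it.\<close>
  have cN: "|N \<times> Pow (N \<times> K)| \<le>o |Pow N|"
  proof -
    have "|K| \<le>o |N|" unfolding N_def by (rule card_of_self_Pow)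
    then have "|N \<times> K| \<le>o |N|"
      using infN by (intro card_of_Times_ordLeq_infinite_Field) (auto simp: Field_card_of card_of_card_order_on intro: card_of_mono1)
    then have "|Pow (N \<times> K)| \<le>o |Pow N|" by (rule card_of_Pow_mono)
    then show ?thesis
      using infN card_of_self_Pow
      by (intro card_of_Times_ordLeq_infinite_Field) (auto simp: Field_card_of card_of_card_order_on intro: card_of_mono1)
  qed
  have "\<exists>z\<in>A. \<forall>k\<in>N. g z k \<noteq> z"
  proof (rule ccontr)
    assume "\<not> (\<exists>z\<in>A. \<forall>k\<in>N. g z k \<noteq> z)"
    then have ex: "\<exists>k. k \<in> N \<and> g z k = z" if "z \<in> A" for z using that by blast
    have "\<exists>k. k \<in> N \<and> g z k = z \<and> (\<forall>j. (j, k) \<in> R \<longrightarrow> g z j \<noteq> z)" if z: "z \<in> A" for z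
    proof -
      from ex[OF z] have "{k. k \<in> N \<and> g z k = z} \<noteq> {}" by blast
      from wfE_min'[OF R(1) this] obtain k where k: "k \<in> N" "g z k = z"
        "\<And>j. (j, k) \<in> R \<Longrightarrow> j \<notin> {k. k \<in> N \<and> g z k = z}" by blast
      then show ?thesis using R(4) by blast
    qed
    then obtain k where k: "\<And>z. z \<in> A \<Longrightarrow> k z \<in> N" "\<And>z. z \<in> A \<Longrightarrow> g z (k z) = z"
      "\<And>z j. z \<in> A \<Longrightarrow> (j, k z) \<in> R \<Longrightarrow> g z j \<noteq> z" by metis
    have inA: "g z j \<in> A" if "z \<in> A" "(j, k z) \<in> R" for z j
    proof -
      have "Q z j z" unfolding Q_def using that k(3) R(2) by (metis transD)
      then have "Q z j (g z j)" unfolding gQ by (rule someI)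
      then show ?thesis by (simp add: Q_def)
    qed
    define c where "c z = (k z, {(j, f (g z j) z) | j. (j, k z) \<in> R})" for z
    have "inj_on c A"
    proof (rule inj_onI)
      fix z z' assume z: "z \<in> A" "z' \<in> A" and "c z = c z'"
      then have kk: "k z = k z'"
        and "{(j, f (g z j) z) | j. (j, k z) \<in> R} = {(j, f (g z' j) z') | j. (j, k z') \<in> R}"
        unfolding c_def prod.inject by blast+
      then have cc: "f (g z j) z = f (g z' j) z'" if "(j, k z) \<in> R" for j
        using that by blast
      \<comment> \<open>Equal codes force the two sequences to agree position by position, because
        the choice condition mentions \<open>z\<close> only through the recorded colours.\<close>
      have gg: "(j, k z) \<in> R \<Longrightarrow> g z j = g z' j" for j
      proof (induction j rule: wf_induct_rule[OF R(1)])
        case (1 j)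
        then have "(i, k z) \<in> R" "g z i = g z' i" if "(i, j) \<in> R" for i
          using that R(2) by (metis transD)+
        then have "Q z j = Q z' j" unfolding Q_def fun_eq_iff using cc by metis
        then show ?case by (simp add: gQ)
      qed
      have "Q z (k z) = Q z' (k z')" unfolding Q_def fun_eq_iff using cc gg kk by metis
      then have "g z (k z) = g z' (k z')" by (simp add: gQ)
      then show "z = z'" using k(2) z by simp
    qed
    moreover have "c ` A \<subseteq> N \<times> Pow (N \<times> K)"
    proof -
      have "f (g z j) z \<in> K" if "z \<in> A" "(j, k z) \<in> R" for z j
        using col inA k(3) that by blast
      then show ?thesis using k(1) R(4) by (auto simp: c_def)
    qed
    ultimately have "|A| \<le>o |N \<times> Pow (N \<times> K)|" unfolding card_of_ordLeq[symmetric] by blast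
    from ordLeq_transitive[OF this cN] have "|A| \<le>o |Pow (Pow K)|" by (simp add: N_def)
    with A show False using not_ordLess_ordLeq by blast
  qed
  then obtain z where z: "z \<in> A" "\<And>k. k \<in> N \<Longrightarrow> g z k \<noteq> z" by blast
  have gz: "Q z k (g z k)" for k
  proof -
    \<comment> \<open>The unreached \<open>z\<close> satisfies every condition itself, so the choice
      behind \<open>g z k\<close> never falls back on an arbitrary value.\<close>
    have "Q z k z" unfolding Q_def using z R(4) by (metis SigmaD1 subsetD)
    then show ?thesis unfolding gQ by (rule someI)
  qed
  have inj: "inj_on (g z) N"
  proof (rule inj_onI, rule ccontr)
    fix x y assume xy: "x \<in> N" "y \<in> N" "g z x = g z y" "x \<noteq> y"
    then have "(x, y) \<in> R \<or> (y, x) \<in> R" using R(3) by (auto simp: total_on_def)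
    then show False using gz[of x] gz[of y] xy(3) unfolding Q_def by metis
  qed
  have colz: "f (g z j) z \<in> K" if "j \<in> N" for j
    using col gz[of j] z that unfolding Q_def by blast
  define C where "C i = {j\<in>N. f (g z j) z = i}" for i
  \<comment> \<open>\<open>N\<close> has more than \<open>|K|\<close> elements and there are only
    \<open>|K|\<close> colours, so one colour class is not smaller than \<open>K\<close>.\<close>
  have "\<exists>i\<in>K. |K| \<le>o |C i|"
  proof (rule ccontr)
    assume "\<not> ?thesis"
    then have "\<forall>i\<in>K. |C i| \<le>o |K|" by (meson card_of_ordLeq_not ordLess_imp_ordLeq)
    then have "|\<Union>i\<in>K. C i| \<le>o |K|"
      using K by (intro card_of_UNION_ordLeq_infinite) (auto simp: card_of_mono1)
    moreover have "(\<Union>i\<in>K. C i) = N" using colz by (auto simp: C_def)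
    ultimately have "|Pow K| \<le>o |K|" by (simp add: N_def)
    then show False using card_of_Pow not_ordLess_ordLeq by blast
  qed
  then obtain i where i: "i \<in> K" "|K| \<le>o |C i|" by blast
  show thesis
  proof (rule that[of "g z ` C i" i])
    show "g z ` C i \<subseteq> A" using gz by (auto simp: Q_def)
    have "inj_on (g z) (C i)" using inj by (rule inj_on_subset) (auto simp: C_def)
    then have "|C i| \<le>o |g z ` C i|" by (metis card_of_ordLeq order_refl)
    with i(2) show "|K| \<le>o |g z ` C i|" by (rule ordLeq_transitive)
    show "i \<in> K" by fact
    fix x y assume "x \<in> g z ` C i" "y \<in> g z ` C i" "x \<noteq> y"
    then obtain j k where jk: "x = g z j" "y = g z k" "j \<in> C i" "k \<in> C i" "j \<noteq> k" by blast
    then have "(j, k) \<in> R \<or> (k, j) \<in> R" using R(3) by (auto simp: total_on_def C_def)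
    then show "f x y = i \<or> f y x = i"
      using gz[of j] gz[of k] jk unfolding Q_def C_def by auto
  qed
qed

section \<open>Calculus of sets bounded by an infinite cardinal\<close>

locale infinite_cardinal =
  fixes mu :: "'b rel"
  assumes Card_order_mu: "Card_order mu" and infinite_mu: "infinite (Field mu)"
begin

definition small :: "'x set \<Rightarrow> bool" where
  "small S \<longleftrightarrow> |S| \<le>o mu"

abbreviation big :: "'x set \<Rightarrow> bool" where
  "big S \<equiv> \<not> small S"

lemma small_subset: "small S \<Longrightarrow> S' \<subseteq> S \<Longrightarrow> small S'"
  unfolding small_def by (meson card_of_mono1 ordLeq_transitive)

lemma big_superset: "big S \<Longrightarrow> S \<subseteq> S' \<Longrightarrow> big S'"
  using small_subset by blast

lemma small_UN: "small I \<Longrightarrow> (\<And>i. i \<in> I \<Longrightarrow> small (A i)) \<Longrightarrow> small (\<Union>i\<in>I. A i)"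
  unfolding small_def using card_of_UNION_ordLeq_infinite_Field[OF infinite_mu Card_order_mu] by blast

lemma small_Un: "small S \<Longrightarrow> small S' \<Longrightarrow> small (S \<union> S')"
  unfolding small_def using card_of_Un_ordLeq_infinite_Field[OF infinite_mu _ _ Card_order_mu] by blast

lemma small_image: "small S \<Longrightarrow> small (f ` S)"
  unfolding small_def by (meson card_of_image ordLeq_transitive)

lemma small_Times: "small S \<Longrightarrow> small S' \<Longrightarrow> small (S \<times> S')"
  unfolding small_def using card_of_Times_ordLeq_infinite_Field[OF infinite_mu _ _ Card_order_mu] by blast

lemma small_finite: "finite S \<Longrightarrow> small S"
  unfolding small_def
  by (metis Card_order_mu card_of_Field_ordIso card_of_Well_order infinite_mu
      card_of_ordLeq_finite ordLeq_ordIso_trans ordLeq_total)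

lemma small_ordLeq: "|S| \<le>o |S'| \<Longrightarrow> small S' \<Longrightarrow> small S"
  unfolding small_def by (rule ordLeq_transitive)

lemma small_inj_on: "inj_on f S \<Longrightarrow> f ` S \<subseteq> S' \<Longrightarrow> small S' \<Longrightarrow> small S"
  by (meson card_of_ordLeq small_ordLeq)

lemma big_Diff: "big S \<Longrightarrow> small S' \<Longrightarrow> big (S - S')"
  using small_Un[of "S - S'" S'] small_subset[of "(S - S') \<union> S'" S] by blast

lemma big_fibre:
  assumes "big S" "small (f ` S)"
  obtains v where "v \<in> f ` S" "big {x\<in>S. f x = v}"
  using small_UN[OF assms(2), of "\<lambda>v. {x\<in>S. f x = v}"] assms(1)
    small_subset[of "\<Union>v\<in>f ` S. {x\<in>S. f x = v}" S] by blast

end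

subsection \<open>Traces on the members of an ideal\<close>

context infinite_cardinal
begin

text \<open>The members of \<open>F\<close> other than its union form an ideal: if two of them had
  the top as their union, their small sets of traces would bound \<open>F\<close>. For infinite
  \<open>K\<close>, if no member of the ideal has \<open>|K|\<close> big traces, the ideal is even
  closed under unions of \<open>|K|\<close> members. A chain of length \<open>K\<close> along which
  some big trace splits at every stage then produces too many big traces on its union.\<close>

lemma many_big_traces:
  fixes F :: "'p set set" and K :: "'k set"
  assumes big: "big F"
    and Int: "\<And>W W'. W \<in> F \<Longrightarrow> W' \<in> F \<Longrightarrow> W \<inter> W' \<in> F"
    and Un: "\<And>S. S \<subseteq> F \<Longrightarrow> S \<noteq> {} \<Longrightarrow> \<Union>S \<in> F"
    and below: "\<And>U. U \<in> F \<Longrightarrow> U \<noteq> \<Union>F \<Longrightarrow> small {W\<in>F. W \<subseteq> U}"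
    and D: "D \<subseteq> F - {\<Union>F}" "small D" "\<And>U. U \<in> F \<Longrightarrow> U \<noteq> \<Union>F \<Longrightarrow> U \<subseteq> \<Union>D"
    and K: "(\<exists>i j. K = {i, j}) \<or> infinite K \<and> small (Pow K)"
  obtains U V where "U \<in> F" "inj_on V K" "\<And>k. k \<in> K \<Longrightarrow> V k \<in> F"
    "\<And>k. k \<in> K \<Longrightarrow> V k \<subseteq> U" "\<And>k. k \<in> K \<Longrightarrow> big {W\<in>F. W \<inter> U = V k}"
proof -
  note result = that
  define I where "I = F - {\<Union>F}"
  have bigI: "big I" unfolding I_def using big by (rule big_Diff) (simp add: small_finite)
  have IF: "U \<in> F" if "U \<in> I" for U using that by (simp add: I_def)
  have traces: "small ((\<lambda>W. W \<inter> U) ` F)" if "U \<in> I" for U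
  proof (rule small_subset)
    show "small {W\<in>F. W \<subseteq> U}" using below that by (simp add: I_def)
    show "(\<lambda>W. W \<inter> U) ` F \<subseteq> {W\<in>F. W \<subseteq> U}" using Int that by (auto simp: I_def)
  qed
  have UnF: "U \<union> U' \<in> F" if "U \<in> F" "U' \<in> F" for U U' using Un[of "{U, U'}"] that by simp
  have UnI: "U \<union> U' \<in> I" if U: "U \<in> I" "U' \<in> I" for U U'
  proof -
    have "U \<union> U' \<noteq> \<Union>F"
    proof
      assume eq: "U \<union> U' = \<Union>F"
      have "inj_on (\<lambda>W. (W \<inter> U, W \<inter> U')) F"
      proof (rule inj_onI)
        fix W W' assume "W \<in> F" "W' \<in> F" and e: "(W \<inter> U, W \<inter> U') = (W' \<inter> U, W' \<inter> U')"
        then have "W = W \<inter> U \<union> W \<inter> U'" "W' = W' \<inter> U \<union> W' \<inter> U'" using eq by blast+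
        then show "W = W'" using e by simp
      qed
      then have "small F"
        by (rule small_inj_on[where S' = "((\<lambda>W. W \<inter> U) ` F) \<times> ((\<lambda>W. W \<inter> U') ` F)"])
          (use small_Times traces U in auto)
      with big show False by simp
    qed
    then show ?thesis using UnF U by (auto simp: I_def)
  qed
  \<comment> \<open>The traces on \<open>U\<close> that many members share. A \<open>U\<close> in
    the ideal admits only few traces at all, so almost every member has a trace in
    \<open>R U\<close>.\<close>
  define R where "R U = {v. big {W\<in>F. W \<inter> U = v}}" for U
  have RF: "\<exists>W\<in>F. W \<inter> U = v" if "v \<in> R U" for U v
  proof (rule ccontr)
    assume "\<not> ?thesis"
    then have "{W\<in>F. W \<inter> U = v} = {}" by blast
    with that show False by (simp add: R_def small_finite)
  qed
  have outR: "small {W\<in>F. W \<inter> U \<notin> R U}" if "U \<in> I" for U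
  proof (rule small_subset)
    show "small (\<Union>v\<in>(\<lambda>W. W \<inter> U) ` F. {W\<in>F. W \<inter> U = v \<and> v \<notin> R U})"
    proof (rule small_UN)
      fix v show "small {W\<in>F. W \<inter> U = v \<and> v \<notin> R U}" by (cases "v \<in> R U") (auto simp: R_def small_finite)
    qed (use traces that in blast)
  qed blast
  have enough: thesis if "U \<in> I" "|K| \<le>o |R U|" for U
  proof -
    from that(2) obtain V where V: "inj_on V K" "V ` K \<subseteq> R U"
      unfolding card_of_ordLeq[symmetric] by blast
    show thesis
    proof (rule result[of U V])
      show "U \<in> F" using that(1) IF by blast
      show "inj_on V K" by fact
      fix k assume k: "k \<in> K"
      then obtain W where W: "W \<in> F" "W \<inter> U = V k" using RF V(2) by blast
      then show "V k \<in> F" "V k \<subseteq> U" using Int[OF W(1) \<open>U \<in> F\<close>] by auto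
      show "big {W\<in>F. W \<inter> U = V k}" using k V(2) by (auto simp: R_def)
    qed
  qed
  \<comment> \<open>If no \<open>d\<close> in \<open>D\<close> split a big trace, then up to a small
    set the members of the ideal would be determined by their trace on \<open>U\<close>: it would
    fix their trace on each \<open>d\<close>, and \<open>D\<close> covers them. But \<open>U\<close>
    has few traces.\<close>
  have refine: "\<exists>d\<in>D. \<exists>v\<in>R (U \<union> d). \<exists>v'\<in>R (U \<union> d). v \<noteq> v' \<and> v \<inter> U = v' \<inter> U" if U: "U \<in> I" for U
  proof (rule ccontr)
    assume neg: "\<not> ?thesis"
    then have neg': "\<And>d v v'. d \<in> D \<Longrightarrow> v \<in> R (U \<union> d) \<Longrightarrow> v' \<in> R (U \<union> d) \<Longrightarrow> v \<inter> U = v' \<inter> U \<Longrightarrow> v = v'"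
      by metis
    define X where "X = (\<Union>d\<in>D. {W\<in>F. W \<inter> (U \<union> d) \<notin> R (U \<union> d)})"
    have "small X" unfolding X_def
      using D(1) by (intro small_UN D(2) outR UnI U) (auto simp: I_def)
    with bigI have "big (I - X)" by (rule big_Diff)
    moreover have "inj_on (\<lambda>W. W \<inter> U) (I - X)"
    proof (rule inj_onI)
      fix W W' assume W: "W \<in> I - X" "W' \<in> I - X" and eq: "W \<inter> U = W' \<inter> U"
      have "W \<inter> d = W' \<inter> d" if "d \<in> D" for d
      proof -
        have "W \<inter> (U \<union> d) \<in> R (U \<union> d)" "W' \<inter> (U \<union> d) \<in> R (U \<union> d)"
          using W that IF unfolding X_def by blast+
        moreover have "W \<inter> (U \<union> d) \<inter> U = W' \<inter> (U \<union> d) \<inter> U" using eq by auto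
        ultimately have "W \<inter> (U \<union> d) = W' \<inter> (U \<union> d)" by (rule neg'[OF that])
        then show ?thesis by blast
      qed
      moreover have "W \<subseteq> \<Union>D" "W' \<subseteq> \<Union>D" using W D(3) by (auto simp: I_def)
      ultimately show "W = W'" by blast
    qed
    then have "small (I - X)"
      by (rule small_inj_on[where S' = "(\<lambda>W. W \<inter> U) ` F"]) (use traces[OF U] IF in auto)
    ultimately show False by blast
  qed
  obtain U0 where U0: "U0 \<in> I" using bigI small_finite[of "{}"] by (cases "I = {}") auto
  from K show thesis
  proof
    assume "\<exists>i j. K = {i, j}"
    then obtain i j where ij: "K = {i, j}" by blast
    from refine[OF U0] obtain d v v' where d: "d \<in> D" "v \<in> R (U0 \<union> d)" "v' \<in> R (U0 \<union> d)" "v \<noteq> v'" by blast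
    then have "inj_on (\<lambda>k. if k = i then v else v') K \<and> (\<lambda>k. if k = i then v else v') ` K \<subseteq> R (U0 \<union> d)"
      by (auto simp: ij inj_on_def)
    then have "|K| \<le>o |R (U0 \<union> d)|" unfolding card_of_ordLeq[symmetric] by blast
    moreover have "U0 \<union> d \<in> I" using UnI U0 d(1) D(1) by (auto simp: I_def)
    ultimately show thesis using enough by blast
  next
    assume K: "infinite K \<and> small (Pow K)"
    show thesis
    proof (rule ccontr)
      assume nothesis: "\<not> thesis"
      then have RK: "|R U| \<le>o |K|" if "U \<in> I" for U
        using enough that card_of_ordLeq_not ordLess_imp_ordLeq by blast
      \<comment> \<open>If the union were the top, almost every member would be coded by its big
        traces on the sets of \<open>J\<close>, hence by a subset of \<open>Sigma J R\<close>. That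
        set has at most \<open>|K|\<close> elements and so at most \<open>mu\<close>
        subsets.\<close>
      have UnJ: "\<Union>J \<in> I" if J: "J \<subseteq> I" "J \<noteq> {}" "|J| \<le>o |K|" for J
      proof (rule ccontr)
        assume "\<Union>J \<notin> I"
        then have eq: "\<Union>J = \<Union>F" using Un[of J] J by (auto simp: I_def)
        define X where "X = (\<Union>U\<in>J. {W\<in>F. W \<inter> U \<notin> R U})"
        have "small J"
          using small_ordLeq[OF ordLeq_transitive[OF J(3) card_of_self_Pow]] K by blast
        then have "small X" unfolding X_def using J outR by (intro small_UN) auto
        with big have "big (F - X)" by (rule big_Diff)
        moreover have "small (F - X)"
        proof (rule small_inj_on)
          show "inj_on (\<lambda>W. {(U, W \<inter> U) | U. U \<in> J}) (F - X)"
          proof (rule inj_onI)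
            fix W W' assume W: "W \<in> F - X" "W' \<in> F - X"
              and e: "{(U, W \<inter> U) | U. U \<in> J} = {(U, W' \<inter> U) | U. U \<in> J}"
            have "W \<inter> U = W' \<inter> U" if "U \<in> J" for U
            proof -
              have "(U, W \<inter> U) \<in> {(U, W' \<inter> U) | U. U \<in> J}" unfolding e[symmetric] using that by blast
              then show ?thesis by simp
            qed
            moreover have "W \<subseteq> \<Union>J" "W' \<subseteq> \<Union>J" using W eq by auto
            ultimately show "W = W'" by blast
          qed
          show "(\<lambda>W. {(U, W \<inter> U) | U. U \<in> J}) ` (F - X) \<subseteq> Pow (Sigma J R)" by (auto simp: X_def)
          have "|Sigma J R| \<le>o |K|"
            using K J RK by (intro card_of_Sigma_ordLeq_infinite) auto
          then show "small (Pow (Sigma J R))"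
            using small_ordLeq[OF card_of_Pow_mono] K by blast
        qed
        ultimately show False by blast
      qed
      \<comment> \<open>The many members with trace \<open>v\<close> on \<open>U\<close> have only
        few traces on \<open>U'\<close>, so one of these is again big, and it restricts to
        \<open>v\<close>.\<close>
      have lift: "\<exists>w\<in>R U'. w \<inter> U = v" if "U' \<in> I" "U \<subseteq> U'" "v \<in> R U" for U U' v
      proof -
        have "big {W\<in>F. W \<inter> U = v}" using that by (simp add: R_def)
        moreover have "small ((\<lambda>W. W \<inter> U') ` {W\<in>F. W \<inter> U = v})"
          using traces[OF that(1)] by (rule small_subset) blast
        ultimately obtain w where w: "w \<in> (\<lambda>W. W \<inter> U') ` {W\<in>F. W \<inter> U = v}"
          "big {W \<in> {W\<in>F. W \<inter> U = v}. W \<inter> U' = w}" by (rule big_fibre)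
        have "big {W\<in>F. W \<inter> U' = w}" using w(2) by (rule big_superset) blast
        then have "w \<in> R U'" by (simp add: R_def)
        moreover have "w \<inter> U = v" using w(1) that(2) by auto
        ultimately show ?thesis by blast
      qed
      from refine have "\<forall>U. \<exists>d v v'. U \<in> I \<longrightarrow> d \<in> D \<and> v \<in> R (U \<union> d) \<and> v' \<in> R (U \<union> d) \<and> v \<noteq> v' \<and> v \<inter> U = v' \<inter> U"
        by blast
      then obtain d v v' where dv: "\<And>U. U \<in> I \<Longrightarrow> d U \<in> D" "\<And>U. U \<in> I \<Longrightarrow> v U \<in> R (U \<union> d U)"
        "\<And>U. U \<in> I \<Longrightarrow> v' U \<in> R (U \<union> d U)" "\<And>U. U \<in> I \<Longrightarrow> v U \<noteq> v' U"
        "\<And>U. U \<in> I \<Longrightarrow> v U \<inter> U = v' U \<inter> U" by metis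
      obtain r where r: "wf r" "trans r" "total_on K r" "r \<subseteq> K \<times> K" by (rule strict_well_order)
      obtain f where f: "\<And>k. f k = (U0 \<union> \<Union>(f ` {j. (j, k) \<in> r})) \<union> d (U0 \<union> \<Union>(f ` {j. (j, k) \<in> r}))"
        using wf_image_recursion[OF r(1), of "\<lambda>X. (U0 \<union> \<Union>X) \<union> d (U0 \<union> \<Union>X)"] by blast
      \<comment> \<open>The stage before \<open>k\<close>; \<open>f k\<close> enlarges it by a set
        of \<open>D\<close> on which two big traces with the same restriction to \<open>A k\<close>
        part.\<close>
      define A where "A k = U0 \<union> \<Union>(f ` {j. (j, k) \<in> r})" for k
      have fA: "f k = A k \<union> d (A k)" for k using f[of k] by (simp add: A_def)
      have small_union: "U0 \<union> \<Union>(f ` L) \<in> I" if "L \<subseteq> K" "\<And>j. j \<in> L \<Longrightarrow> f j \<in> I" for L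
      proof -
        have "|f ` L| \<le>o |K|" using card_of_image[of f L] card_of_mono1[OF that(1)] by (rule ordLeq_transitive)
        then have "\<Union>(f ` L) \<in> I" if "L \<noteq> {}" using UnJ[of "f ` L"] \<open>\<And>j. j \<in> L \<Longrightarrow> f j \<in> I\<close> that by blast
        then show ?thesis using U0 UnI by (cases "L = {}") auto
      qed
      have AfI: "A k \<in> I \<and> f k \<in> I" for k
      proof (induction k rule: wf_induct_rule[OF r(1)])
        case (1 k)
        then have "A k \<in> I" unfolding A_def using r(4) by (intro small_union) auto
        moreover from this have "d (A k) \<in> I" using dv(1) D(1) by (auto simp: I_def)
        ultimately show ?case using UnI fA by simp
      qed
      define U where "U = U0 \<union> \<Union>(f ` K)"
      have UI: "U \<in> I" unfolding U_def using AfI by (intro small_union) auto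
      have "\<forall>k\<in>K. \<exists>w w'. w \<in> R U \<and> w' \<in> R U \<and> w \<inter> f k = v (A k) \<and> w' \<inter> f k = v' (A k)"
      proof
        fix k assume "k \<in> K"
        then have "f k \<subseteq> U" by (auto simp: U_def)
        have AI: "A k \<in> I" using AfI by blast
        have "v (A k) \<in> R (f k)" "v' (A k) \<in> R (f k)"
          unfolding fA by (rule dv(2)[OF AI], rule dv(3)[OF AI])
        from lift[OF UI \<open>f k \<subseteq> U\<close> this(1)] lift[OF UI \<open>f k \<subseteq> U\<close> this(2)]
        show "\<exists>w w'. w \<in> R U \<and> w' \<in> R U \<and> w \<inter> f k = v (A k) \<and> w' \<inter> f k = v' (A k)"
          by blast
      qed
      then obtain w w' where w: "\<And>k. k \<in> K \<Longrightarrow> w k \<in> R U" "\<And>k. k \<in> K \<Longrightarrow> w' k \<in> R U"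
        "\<And>k. k \<in> K \<Longrightarrow> w k \<inter> f k = v (A k)" "\<And>k. k \<in> K \<Longrightarrow> w' k \<inter> f k = v' (A k)" by metis
      \<comment> \<open>The two traces chosen for the later \<open>l\<close> agree on
        \<open>A l\<close>, which contains \<open>f k\<close>, while those chosen for
        \<open>k\<close> differ on \<open>f k\<close>. Hence the pairs differ, although single
        traces may coincide; this is why pairs are counted.\<close>
      have separated: "(w k, w' k) \<noteq> (w l, w' l)" if kl: "(k, l) \<in> r" for k l
      proof -
        have "k \<in> K" "l \<in> K" using kl r(4) by auto
        have "w k \<inter> f k \<noteq> w' k \<inter> f k" using w(3,4)[OF \<open>k \<in> K\<close>] dv(4) AfI by metis
        moreover have "w l \<inter> f l \<inter> A l = w' l \<inter> f l \<inter> A l" using w(3,4)[OF \<open>l \<in> K\<close>] dv(5) AfI by metis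
        moreover have "f k \<subseteq> A l" "A l \<subseteq> f l" using kl fA[of l] by (auto simp: A_def)
        ultimately have ne: "w k \<inter> f k \<noteq> w' k \<inter> f k"
          and eq: "w l \<inter> f l \<inter> A l \<inter> f k = w' l \<inter> f l \<inter> A l \<inter> f k"
          and sub: "f l \<inter> A l \<inter> f k = f k" by auto
        show ?thesis
        proof
          assume "(w k, w' k) = (w l, w' l)"
          with ne eq show False unfolding Int_assoc sub[unfolded Int_assoc] by simp
        qed
      qed
      have "inj_on (\<lambda>k. (w k, w' k)) K"
      proof (rule inj_onI, rule ccontr)
        fix k l assume "k \<in> K" "l \<in> K" "k \<noteq> l" and eq: "(w k, w' k) = (w l, w' l)"
        then have "(k, l) \<in> r \<or> (l, k) \<in> r" using r(3) by (auto simp: total_on_def)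
        then show False using separated eq by metis
      qed
      moreover have "(\<lambda>k. (w k, w' k)) ` K \<subseteq> R U \<times> R U" using w(1,2) by auto
      ultimately have KR: "|K| \<le>o |R U \<times> R U|" unfolding card_of_ordLeq[symmetric] by blast
      have "infinite (R U)"
        using K KR card_of_ordLeq_infinite by (metis finite_SigmaI)
      then have "|R U \<times> R U| =o |R U|" by (rule card_of_Times_same_infinite)
      with KR have "|K| \<le>o |R U|" by (rule ordLeq_ordIso_trans)
      with UI enough nothesis show False by blast
    qed
  qed
qed

end

subsection \<open>Splitting a family of open sets\<close>

locale small_base = infinite_cardinal mu for mu :: "'b rel" +
  fixes Omega :: "'p topology" and B :: "'p set set"
  assumes small_B: "|B| \<le>o mu"
    and openin_B: "\<And>b. b \<in> B \<Longrightarrow> openin Omega b"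
    and base: "\<And>U x. openin Omega U \<Longrightarrow> x \<in> U \<Longrightarrow> \<exists>b\<in>B. x \<in> b \<and> b \<subseteq> U"
begin

lemma small_B_set: "small B"
  using small_B by (simp add: small_def)

text \<open>Every member of \<open>N\<close> includes one of the at most \<open>mu\<close> basic
  neighbourhoods of \<open>x\<close>, so one of these is shared by many members.\<close>

lemma big_basic_subset:
  assumes "big N" "\<And>W. W \<in> N \<Longrightarrow> openin Omega W" "\<And>W. W \<in> N \<Longrightarrow> x \<in> W"
  obtains b where "b \<in> B" "x \<in> b" "big {W\<in>N. b \<subseteq> W}"
proof -
  have "\<exists>b\<in>B. x \<in> b \<and> big {W\<in>N. b \<subseteq> W}"
  proof (rule ccontr)
    assume neg: "\<not> ?thesis"
    have "small {b\<in>B. x \<in> b}" using small_B_set by (rule small_subset) blast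
    then have "small (\<Union>b\<in>{b\<in>B. x \<in> b}. {W\<in>N. b \<subseteq> W})"
      by (rule small_UN) (use neg in blast)
    moreover have "N \<subseteq> (\<Union>b\<in>{b\<in>B. x \<in> b}. {W\<in>N. b \<subseteq> W})"
    proof
      fix W assume W: "W \<in> N"
      obtain b where "b \<in> B" "x \<in> b" "b \<subseteq> W" using base[OF assms(2,3)[OF W]] by blast
      with W show "W \<in> (\<Union>b\<in>{b\<in>B. x \<in> b}. {W\<in>N. b \<subseteq> W})" by blast
    qed
    ultimately have "small N" by (rule small_subset)
    with assms(1) show False ..
  qed
  then show thesis using that by blast
qed

text \<open>The two inclusions together say \<open>W \<inter> Y = V \<inter> Y\<close>. The pairs
  \<open>(Y, V)\<close> become the nodes of the tree.\<close>

definition extensions :: "'p set \<Rightarrow> 'p set \<Rightarrow> 'p set set" where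
  "extensions Y V = {W. openin Omega W \<and> V \<subseteq> W \<and> W \<inter> Y \<subseteq> V}"

text \<open>A point of \<open>V' k \<inter> Y' l - V' l\<close> lies in every member of family
  \<open>k\<close> and in no member of family \<open>l\<close>. Which of the two families gets the
  point is left open, as the constructions control only one direction.\<close>

definition splits :: "'k set \<Rightarrow> 'p set \<Rightarrow> 'p set \<Rightarrow> bool" where
  "splits K Y V \<longleftrightarrow> (\<exists>Y' V'.
     (\<forall>k\<in>K. Y \<subseteq> Y' k \<and> V' k \<in> extensions Y V \<and> big (extensions (Y' k) (V' k))) \<and>
     (\<forall>k\<in>K. \<forall>l\<in>K. k \<noteq> l \<longrightarrow> V' k \<inter> Y' l - V' l \<noteq> {} \<or> V' l \<inter> Y' k - V' k \<noteq> {}))"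

lemma splitsI:
  assumes "\<And>k. k \<in> K \<Longrightarrow> Y \<subseteq> Y' k" "\<And>k. k \<in> K \<Longrightarrow> V' k \<in> extensions Y V"
    "\<And>k. k \<in> K \<Longrightarrow> big (extensions (Y' k) (V' k))"
    "\<And>k l. k \<in> K \<Longrightarrow> l \<in> K \<Longrightarrow> k \<noteq> l \<Longrightarrow> V' k \<inter> Y' l - V' l \<noteq> {} \<or> V' l \<inter> Y' k - V' k \<noteq> {}"
  shows "splits K Y V"
  unfolding splits_def
  by (rule exI[of _ Y'], rule exI[of _ V'], intro conjI ballI impI) (rule assms; assumption)+

lemma big_nonempty: "big S \<Longrightarrow> S \<noteq> {}"
  using small_finite by auto

lemma splits_ordLeq:
  assumes "splits L Y V" "|K| \<le>o |L|"
  shows "splits K Y V"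
proof -
  obtain h where h: "inj_on h K" "h ` K \<subseteq> L" using assms(2) unfolding card_of_ordLeq[symmetric] by blast
  from assms(1) obtain Y' V' where
    Y': "\<forall>k\<in>L. Y \<subseteq> Y' k \<and> V' k \<in> extensions Y V \<and> big (extensions (Y' k) (V' k))"
      "\<forall>k\<in>L. \<forall>l\<in>L. k \<noteq> l \<longrightarrow> V' k \<inter> Y' l - V' l \<noteq> {} \<or> V' l \<inter> Y' k - V' k \<noteq> {}"
    unfolding splits_def by (elim exE conjE)
  show ?thesis
  proof (rule splitsI[where Y' = "Y' \<circ> h" and V' = "V' \<circ> h"])
    fix k l assume "k \<in> K" "l \<in> K" "k \<noteq> l"
    then have "h k \<in> L" "h l \<in> L" "h k \<noteq> h l" using h by (auto dest: inj_onD)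
    then show "(V' \<circ> h) k \<inter> (Y' \<circ> h) l - (V' \<circ> h) l \<noteq> {} \<or> (V' \<circ> h) l \<inter> (Y' \<circ> h) k - (V' \<circ> h) k \<noteq> {}"
      using Y'(2) by simp
  next
    fix k assume "k \<in> K"
    then have "h k \<in> L" using h(2) by blast
    from Y'(1)[THEN bspec, OF this] show "Y \<subseteq> (Y' \<circ> h) k" "(V' \<circ> h) k \<in> extensions Y V"
      "big (extensions ((Y' \<circ> h) k) ((V' \<circ> h) k))" by simp_all
  qed
qed

text \<open>
  If no point splits the big family N, then almost all its members lie in the set A of the
  points that belong to almost all members of N. A member W of N inside A that is not
  the largest one misses a point of A, so W has few subsets in N.
\<close>

lemma splits_of_unsplit_node:
  fixes K :: "'k set"
  assumes K: "(\<exists>i j. K = {i, j}) \<or> infinite K \<and> small (Pow K)"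
    and N: "N = {W \<in> extensions Y V. P \<subseteq> W \<and> W \<inter> Q = {}}" "big N"
    and unsplit: "\<And>x. small {W\<in>N. x \<in> W} \<or> small {W\<in>N. x \<notin> W}"
  shows "splits K Y V"
proof -
  have op: "openin Omega W" if "W \<in> N" for W using that by (simp add: N(1) extensions_def)
  have NInt: "W \<inter> W' \<in> N" if "W \<in> N" "W' \<in> N" for W W'
    using that openin_Int unfolding N(1) extensions_def by blast
  have NUn: "\<Union>S \<in> N" if "S \<subseteq> N" "S \<noteq> {}" for S
    using that openin_Union[of S Omega] unfolding N(1) extensions_def by blast
  define A where "A = {x. small {W\<in>N. x \<notin> W}}"
  define F where "F = {W\<in>N. W \<subseteq> A}"
  \<comment> \<open>A member not inside \<open>A\<close> includes a basic set with a point outside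
    \<open>A\<close>, and by \<open>unsplit\<close> few members contain such a point.\<close>
  have "small {W\<in>N. \<not> W \<subseteq> A}"
  proof (rule small_subset)
    show "small (\<Union>b\<in>{b\<in>B. \<not> b \<subseteq> A}. {W\<in>N. b \<subseteq> W})"
    proof (rule small_UN)
      show "small {b\<in>B. \<not> b \<subseteq> A}" using small_B_set by (rule small_subset) blast
      fix b assume "b \<in> {b\<in>B. \<not> b \<subseteq> A}"
      then obtain x where "x \<in> b" "x \<notin> A" by blast
      then have "small {W\<in>N. x \<in> W}" using unsplit by (auto simp: A_def)
      then show "small {W\<in>N. b \<subseteq> W}" by (rule small_subset) (use \<open>x \<in> b\<close> in blast)
    qed
    show "{W\<in>N. \<not> W \<subseteq> A} \<subseteq> (\<Union>b\<in>{b\<in>B. \<not> b \<subseteq> A}. {W\<in>N. b \<subseteq> W})"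
    proof
      fix W assume W: "W \<in> {W\<in>N. \<not> W \<subseteq> A}"
      then obtain x where x: "x \<in> W" "x \<notin> A" by blast
      then obtain b where "b \<in> B" "x \<in> b" "b \<subseteq> W" using base op W by blast
      then show "W \<in> (\<Union>b\<in>{b\<in>B. \<not> b \<subseteq> A}. {W\<in>N. b \<subseteq> W})" using x W by blast
    qed
  qed
  with N(2) have "big (N - {W\<in>N. \<not> W \<subseteq> A})" by (rule big_Diff)
  moreover have "N - {W\<in>N. \<not> W \<subseteq> A} = F" by (auto simp: F_def)
  ultimately have bigF: "big F" by simp
  have FN: "F \<subseteq> N" by (auto simp: F_def)
  have FUn: "\<Union>S \<in> F" if "S \<subseteq> F" "S \<noteq> {}" for S
    using NUn[of S] that by (auto simp: F_def)
  \<comment> \<open>For each basic set below some member other than the top, one such member is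
    chosen. These at most \<open>mu\<close> sets together cover every member other than the top and
    serve as the family \<open>D\<close> of the trace lemma.\<close>
  have "\<forall>b. \<exists>W. (\<exists>W\<in>F - {\<Union>F}. b \<subseteq> W) \<longrightarrow> W \<in> F - {\<Union>F} \<and> b \<subseteq> W" by blast
  then obtain w where "\<forall>b. (\<exists>W\<in>F - {\<Union>F}. b \<subseteq> W) \<longrightarrow> w b \<in> F - {\<Union>F} \<and> b \<subseteq> w b"
    by (rule choice[THEN exE])
  then have w: "\<And>b. \<exists>W\<in>F - {\<Union>F}. b \<subseteq> W \<Longrightarrow> w b \<in> F - {\<Union>F} \<and> b \<subseteq> w b" by blast
  define B1 where "B1 = {b\<in>B. \<exists>W\<in>F - {\<Union>F}. b \<subseteq> W}"
  obtain U X where UX: "U \<in> F" "inj_on X K" "\<And>k. k \<in> K \<Longrightarrow> X k \<in> F"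
    "\<And>k. k \<in> K \<Longrightarrow> X k \<subseteq> U" "\<And>k. k \<in> K \<Longrightarrow> big {W\<in>F. W \<inter> U = X k}"
  proof (rule many_big_traces[OF bigF, of "w ` B1" K])
    show "W \<inter> W' \<in> F" if "W \<in> F" "W' \<in> F" for W W' using NInt that by (auto simp: F_def)
    show "\<Union>S \<in> F" if "S \<subseteq> F" "S \<noteq> {}" for S using FUn that by blast
    show "small {W\<in>F. W \<subseteq> U}" if U: "U \<in> F" "U \<noteq> \<Union>F" for U
    proof -
      obtain x W where x: "x \<in> W" "W \<in> F" "x \<notin> U" using U by blast
      then have "small {W\<in>N. x \<notin> W}" by (auto simp: F_def A_def)
      then show ?thesis by (rule small_subset) (use x FN in blast)
    qed
    show "w ` B1 \<subseteq> F - {\<Union>F}" using w by (auto simp: B1_def)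
    have "small B1" using small_B_set by (rule small_subset) (auto simp: B1_def)
    then show "small (w ` B1)" by (rule small_image)
    show "U \<subseteq> \<Union>(w ` B1)" if U: "U \<in> F" "U \<noteq> \<Union>F" for U
    proof
      fix x assume "x \<in> U"
      then obtain b where b: "b \<in> B" "x \<in> b" "b \<subseteq> U" using base op U(1) FN by blast
      then have "\<exists>W\<in>F - {\<Union>F}. b \<subseteq> W" using U by blast
      then show "x \<in> \<Union>(w ` B1)" using w[of b] b unfolding B1_def by blast
    qed
    show "(\<exists>i j. K = {i, j}) \<or> infinite K \<and> small (Pow K)" by (rule K)
  qed blast
  have XE: "X k \<in> extensions Y V" if "k \<in> K" for k using UX(3)[OF that] FN by (auto simp: N(1))
  \<comment> \<open>All traces are prescribed on the common set \<open>U\<close>; distinct traces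
    \<open>X k\<close> and \<open>X l\<close> differ in a point of \<open>U\<close>.\<close>
  show ?thesis
  proof (rule splitsI[where Y' = "\<lambda>_. Y \<union> U" and V' = "X"])
    fix k assume k: "k \<in> K"
    show "X k \<in> extensions Y V" using XE k .
    have "{W\<in>F. W \<inter> U = X k} \<subseteq> extensions (Y \<union> U) (X k)"
    proof
      fix W assume W: "W \<in> {W\<in>F. W \<inter> U = X k}"
      then have "W \<in> extensions Y V" using FN by (auto simp: N(1))
      then show "W \<in> extensions (Y \<union> U) (X k)" using W XE[OF k] by (auto simp: extensions_def)
    qed
    with UX(5)[OF k] show "big (extensions (Y \<union> U) (X k))" by (rule big_superset)
    fix l assume l: "l \<in> K" "k \<noteq> l"
    then have "X k \<noteq> X l" using UX(2) k by (auto dest: inj_onD)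
    then show "X k \<inter> (Y \<union> U) - X l \<noteq> {} \<or> X l \<inter> (Y \<union> U) - X k \<noteq> {}"
      using UX(4)[OF k] UX(4)[OF l(1)] by blast
  qed auto
qed

text \<open>If no point splits the family, the ideal argument applies directly. Otherwise a
  splitting point \<open>x\<close> does: one side takes a basic neighbourhood of \<open>x\<close>
  into \<open>V\<close>, the other adds \<open>x\<close> to \<open>Y\<close> and so omits it, since
  \<open>x\<close> is not in \<open>V\<close>.\<close>

lemma splits_two:
  assumes V: "openin Omega V" and big: "big (extensions Y V)"
  shows "splits (UNIV :: bool set) Y V"
proof (cases "\<forall>x. small {W\<in>extensions Y V. x \<in> W} \<or> small {W\<in>extensions Y V. x \<notin> W}")
  case True
  show ?thesis
    by (rule splits_of_unsplit_node[where N = "extensions Y V" and P = "{}" and Q = "{}"])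
      (use True big UNIV_bool in auto)
next
  case False
  then obtain x where x: "big {W\<in>extensions Y V. x \<in> W}" "big {W\<in>extensions Y V. x \<notin> W}" by blast
  obtain b where b: "b \<in> B" "x \<in> b" "big {W\<in>{W\<in>extensions Y V. x \<in> W}. b \<subseteq> W}"
    by (rule big_basic_subset[OF x(1), of x]) (auto simp: extensions_def)
  obtain W where W: "W \<in> extensions Y V" "b \<subseteq> W" using big_nonempty[OF b(3)] by blast
  obtain W' where W': "W' \<in> extensions Y V" "x \<notin> W'" using big_nonempty[OF x(2)] by blast
  show ?thesis
  proof (rule splitsI[where Y' = "\<lambda>k. if k then Y else insert x Y" and V' = "\<lambda>k. if k then V \<union> b else V"])
    fix k l :: bool
    show "Y \<subseteq> (if k then Y else insert x Y)" by auto
    show "(if k then V \<union> b else V) \<in> extensions Y V"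
      using W V openin_B[OF b(1)] by (auto simp: extensions_def intro: openin_Un)
    show "big (extensions (if k then Y else insert x Y) (if k then V \<union> b else V))"
    proof (cases k)
      case True
      have "big (extensions Y (V \<union> b))"
        using b(3) by (rule big_superset) (auto simp: extensions_def)
      then show ?thesis using True by simp
    next
      case False
      have "big (extensions (insert x Y) V)"
        using x(2) by (rule big_superset) (auto simp: extensions_def)
      then show ?thesis using False by simp
    qed
    assume "k \<noteq> l"
    moreover have "x \<in> (V \<union> b) \<inter> insert x Y - V" using b(2) W' by (auto simp: extensions_def)
    ultimately show "(if k then V \<union> b else V) \<inter> (if l then Y else insert x Y) - (if l then V \<union> b else V) \<noteq> {}
        \<or> (if l then V \<union> b else V) \<inter> (if k then Y else insert x Y) - (if k then V \<union> b else V) \<noteq> {}"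
      by (cases k; cases l) auto
  qed
qed

text \<open>
  If every big node is split by a point, then almost every member W of the family runs
  through a tree of splitting points of height L all of whose nodes are big. The points that W
  omits are handled by single basic sets. Those that it contains have to be
  covered by few open sets at a time, and a homogeneous subset makes one of these
  sets contain all earlier points.
\<close>

lemma splits_infinite:
  fixes K :: "'k set" and L :: "'l set"
  assumes V: "openin Omega V" and big: "big (extensions Y V)"
    and K: "infinite K" and L: "|Pow (Pow K)| <o |L|" "small (Pow L)"
    and Bs: "small Bs"
    and cover: "\<And>W a. openin Omega W \<Longrightarrow> a \<subseteq> W \<Longrightarrow> |a| \<le>o |L| \<Longrightarrow>
      \<exists>G. (\<forall>i\<in>K. G i \<in> Bs \<and> openin Omega (G i) \<and> G i \<subseteq> W) \<and> a \<subseteq> (\<Union>i\<in>K. G i)"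
  shows "splits K Y V"
proof (cases "\<exists>P Q. big {W\<in>extensions Y V. P \<subseteq> W \<and> W \<inter> Q = {}} \<and>
    (\<forall>x. small {W\<in>{W\<in>extensions Y V. P \<subseteq> W \<and> W \<inter> Q = {}}. x \<in> W}
       \<or> small {W\<in>{W\<in>extensions Y V. P \<subseteq> W \<and> W \<inter> Q = {}}. x \<notin> W})")
  \<comment> \<open>Some node of the tree, given by points \<open>P\<close> to contain and points
    \<open>Q\<close> to avoid, is big but split by no point.\<close>
  case True
  have "|K| \<le>o |L|"
    using card_of_self_Pow[of K] card_of_self_Pow[of "Pow K"] ordLess_imp_ordLeq[OF L(1)]
    by (blast intro: ordLeq_transitive)
  then have "small (Pow K)" using L(2) card_of_Pow_mono small_ordLeq by blast
  then have K': "(\<exists>i j. K = {i, j}) \<or> infinite K \<and> small (Pow K)" using K by blast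
  from True obtain P Q where N: "big {W\<in>extensions Y V. P \<subseteq> W \<and> W \<inter> Q = {}}"
    and unsplit: "\<forall>x. small {W\<in>{W\<in>extensions Y V. P \<subseteq> W \<and> W \<inter> Q = {}}. x \<in> W}
       \<or> small {W\<in>{W\<in>extensions Y V. P \<subseteq> W \<and> W \<inter> Q = {}}. x \<notin> W}"
    by (elim exE conjE)
  show ?thesis by (rule splits_of_unsplit_node[OF K' refl N]) (rule spec[OF unsplit])
next
  case False
  define F where "F = extensions Y V"
  have bigF: "big F" using big by (simp add: F_def)
  have op: "openin Omega W" if "W \<in> F" for W using that by (simp add: F_def extensions_def)
  obtain r where r: "wf r" "trans r" "total_on L r" "r \<subseteq> L \<times> L" by (rule strict_well_order)
  \<comment> \<open>At big nodes a splitting point exists by the case assumption. At small nodes the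
    value is arbitrary; members passing through those are discarded as \<open>bad\<close>.\<close>
  define point where "point N = (SOME x. big {W\<in>N. x \<in> W} \<and> big {W\<in>N. x \<notin> W})" for N :: "'p set set"
  define agree where "agree W X = {W'\<in>F. \<forall>x\<in>X. x \<in> W' \<longleftrightarrow> x \<in> W}" for W X
  have point: "big {W'\<in>agree W X. point (agree W X) \<in> W'} \<and> big {W'\<in>agree W X. point (agree W X) \<notin> W'}"
    if "big (agree W X)" for W X
  proof -
    have "agree W X = {W'\<in>extensions Y V. X \<inter> W \<subseteq> W' \<and> W' \<inter> (X - W) = {}}"
      by (auto simp: agree_def F_def)
    then have "\<exists>x. big {W'\<in>agree W X. x \<in> W'} \<and> big {W'\<in>agree W X. x \<notin> W'}"
      using spec[OF spec[OF False[unfolded not_ex], of "X \<inter> W"], of "X - W"] that by simp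
    then show ?thesis unfolding point_def by (rule someI_ex)
  qed
  \<comment> \<open>\<open>p W k\<close> is the \<open>k\<close>-th point on the path of
    \<open>W\<close> through the tree; it depends on \<open>W\<close> only through its membership
    answers at earlier points.\<close>
  have "\<forall>W. \<exists>p. \<forall>k. p k = point (agree W (p ` {j. (j, k) \<in> r}))"
  proof
    fix W
    obtain p where "\<And>k. p k = point (agree W (p ` {j. (j, k) \<in> r}))"
      by (rule wf_image_recursion[OF r(1), of "\<lambda>X. point (agree W X)"]) blast
    then show "\<exists>p. \<forall>k. p k = point (agree W (p ` {j. (j, k) \<in> r}))" by blast
  qed
  then obtain p where "\<forall>W k. p W k = point (agree W (p W ` {j. (j, k) \<in> r}))"
    by (rule choice[THEN exE])
  then have p: "\<And>W k. p W k = point (agree W (p W ` {j. (j, k) \<in> r}))" by blast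
  define node where "node W k = agree W (p W ` {j. (j, k) \<in> r})" for W k
  have node: "node W k = {W'\<in>F. \<forall>j. (j, k) \<in> r \<longrightarrow> (p W j \<in> W' \<longleftrightarrow> p W j \<in> W)}" for W k
    by (auto simp: node_def agree_def)
  have p_node: "p W k = point (node W k)" for W k unfolding node_def by (rule p)
  define sig where "sig W k = {j. (j, k) \<in> r \<and> p W j \<in> W}" for W k
  have node_eq: "node W k = node W' k" if "sig W k = sig W' k" for W W' k
  proof -
    have same: "p W j \<in> W \<longleftrightarrow> p W' j \<in> W'" if "(j, k) \<in> r" for j
      using that \<open>sig W k = sig W' k\<close> by (auto simp: sig_def set_eq_iff)
    have "(j, k) \<in> r \<Longrightarrow> p W j = p W' j" for j
    proof (induction j rule: wf_induct_rule[OF r(1)])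
      case (1 j)
      have "p W i = p W' i \<and> (p W i \<in> W \<longleftrightarrow> p W' i \<in> W')" if "(i, j) \<in> r" for i
        using 1 same that r(2) by (meson transD)
      then have "node W j = node W' j" unfolding node by (intro Collect_cong) metis
      then show ?case by (simp add: p_node)
    qed
    then show ?thesis unfolding node using same by (intro Collect_cong) metis
  qed
  \<comment> \<open>A node is determined by its height \<open>k\<close> and the signature
    \<open>sig W k\<close>, so at most \<open>mu\<close> nodes occur. Few members pass through a
    given small node, hence few are bad.\<close>
  define bad where "bad = {W\<in>F. \<exists>k\<in>L. small (node W k)}"
  have "small bad"
  proof (rule small_subset)
    have "small (L \<times> Pow L)" using L(2) small_ordLeq[OF card_of_self_Pow] small_Times by blast
    then show "small (\<Union>ks\<in>L \<times> Pow L. {W\<in>F. small (node W (fst ks)) \<and> sig W (fst ks) = snd ks})"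
    proof (rule small_UN)
      fix ks assume "ks \<in> L \<times> Pow L"
      obtain k s where ks: "ks = (k, s)" by force
      have "small {W\<in>F. small (node W k) \<and> sig W k = s}"
      proof (cases "{W\<in>F. small (node W k) \<and> sig W k = s} = {}")
        case True
        then show ?thesis by (simp only: small_finite finite.emptyI)
      next
        case False
        then obtain W where W: "W \<in> F" "small (node W k)" "sig W k = s" by blast
        have "{W\<in>F. small (node W k) \<and> sig W k = s} \<subseteq> node W k"
        proof
          fix W' assume "W' \<in> {W\<in>F. small (node W k) \<and> sig W k = s}"
          then have "W' \<in> F" "sig W k = sig W' k" using W(3) by simp_all
          from this(1) node_eq[OF this(2)] show "W' \<in> node W k" by (simp add: node)
        qed
        with W(2) show ?thesis by (rule small_subset)
      qed
      then show "small {W\<in>F. small (node W (fst ks)) \<and> sig W (fst ks) = snd ks}" by (simp add: ks)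
    qed
    have "sig W k \<in> Pow L" for W k using r(4) by (auto simp: sig_def)
    then show "bad \<subseteq> (\<Union>ks\<in>L \<times> Pow L. {W\<in>F. small (node W (fst ks)) \<and> sig W (fst ks) = snd ks})"
      unfolding bad_def by fastforce
  qed
  with bigF have "big (F - bad)" by (rule big_Diff)
  then obtain W where "W \<in> F - bad" using big_nonempty by blast
  then have WF: "W \<in> F" and bign: "\<And>k. k \<in> L \<Longrightarrow> big (node W k)" by (auto simp: bad_def)
  define x where "x = p W"
  have xin: "big {W'\<in>node W k. x k \<in> W'}" and xout: "big {W'\<in>node W k. x k \<notin> W'}" if "k \<in> L" for k
    using point[of W "p W ` {j. (j, k) \<in> r}"] bign[OF that] p_node[of W k] by (simp_all add: node_def x_def)
  have nodeF: "W' \<in> F" if "W' \<in> node W k" for W' k using that by (simp add: node)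
  have nodex: "x j \<in> W' \<longleftrightarrow> x j \<in> W" if "W' \<in> node W k" "(j, k) \<in> r" for W' j k
    using that by (simp add: node x_def)
  have rtot: "(j, k) \<in> r \<or> (k, j) \<in> r" if "j \<in> L" "k \<in> L" "j \<noteq> k" for j k
    using that r(3) by (auto simp: total_on_def)
  \<comment> \<open>\<open>S\<close> marks the points of the path that \<open>W\<close> contains.
    Either \<open>S\<close> is large enough for the Erdos-Rado argument, or at least
    \<open>|K|\<close> points are omitted.\<close>
  define S where "S = {k\<in>L. x k \<in> W}"
  show ?thesis
  proof (cases "|Pow (Pow K)| <o |S|")
    case False
    define M where "M k = {W'\<in>node W k. x k \<in> W'}" for k
    have "\<forall>k\<in>L - S. \<exists>b. b \<in> B \<and> x k \<in> b \<and> big {W'\<in>M k. b \<subseteq> W'}"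
    proof
      fix k assume k: "k \<in> L - S"
      then have "big (M k)" using xin unfolding M_def by blast
      then obtain b where "b \<in> B" "x k \<in> b" "big {W'\<in>M k. b \<subseteq> W'}"
        by (rule big_basic_subset) (auto simp: M_def intro: op nodeF)
      then show "\<exists>b. b \<in> B \<and> x k \<in> b \<and> big {W'\<in>M k. b \<subseteq> W'}" by blast
    qed
    then obtain b where "\<forall>k\<in>L - S. b k \<in> B \<and> x k \<in> b k \<and> big {W'\<in>M k. b k \<subseteq> W'}"
      by (rule bchoice[THEN exE])
    then have b: "b k \<in> B" "x k \<in> b k" "big {W'\<in>M k. b k \<subseteq> W'}" if "k \<in> L - S" for k
      using that by simp_all
    \<comment> \<open>For \<open>j\<close> before \<open>k\<close>, the point \<open>x j\<close>
      lies in \<open>b j\<close> but is barred at \<open>k\<close>, since the members of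
      \<open>M k\<close> follow the path of \<open>W\<close> and omit it.\<close>
    have "splits (L - S) Y V"
    proof (rule splitsI[where Y' = "\<lambda>k. Y \<union> {x j | j. (j, k) \<in> r \<and> j \<notin> S}" and V' = "\<lambda>k. V \<union> b k"])
      fix k assume k: "k \<in> L - S"
      have sub: "W' \<in> extensions (Y \<union> {x j | j. (j, k) \<in> r \<and> j \<notin> S}) (V \<union> b k) \<and>
          V \<union> b k \<in> extensions Y V \<and> {x j | j. (j, k) \<in> r \<and> j \<notin> S} \<inter> (V \<union> b k) = {}"
        if W': "W' \<in> {W'\<in>M k. b k \<subseteq> W'}" for W'
      proof -
        have "W' \<in> extensions Y V" "b k \<subseteq> W'" using W' nodeF by (auto simp: F_def M_def)
        moreover have "x j \<notin> W'" if "(j, k) \<in> r" "j \<notin> S" for j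
          using nodex[of W' k j] W' that r(4) by (auto simp: S_def M_def)
        ultimately show ?thesis using V openin_B[OF b(1)[OF k]] by (auto simp: extensions_def)
      qed
      show "Y \<subseteq> Y \<union> {x j | j. (j, k) \<in> r \<and> j \<notin> S}" by blast
      show "V \<union> b k \<in> extensions Y V" using sub big_nonempty[OF b(3)[OF k]] by blast
      show "big (extensions (Y \<union> {x j | j. (j, k) \<in> r \<and> j \<notin> S}) (V \<union> b k))"
        using b(3)[OF k] by (rule big_superset) (use sub in blast)
    next
      have sep: "x j \<in> (V \<union> b j) \<inter> (Y \<union> {x j | j. (j, k) \<in> r \<and> j \<notin> S}) - (V \<union> b k)"
        if jk: "j \<in> L - S" "k \<in> L - S" "(j, k) \<in> r" for j k
      proof -
        obtain W' where W': "W' \<in> {W'\<in>M k. b k \<subseteq> W'}"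
          using big_nonempty[OF b(3)[OF jk(2)]] by blast
        then have "x j \<notin> W'" using nodex[of W' k j] that by (auto simp: S_def M_def)
        moreover have "V \<union> b k \<subseteq> W'" using W' nodeF by (auto simp: F_def extensions_def M_def)
        ultimately show ?thesis using that b(2) by auto
      qed
      fix k l assume "k \<in> L - S" "l \<in> L - S" "k \<noteq> l"
      then show "(V \<union> b k) \<inter> (Y \<union> {x j | j. (j, l) \<in> r \<and> j \<notin> S}) - (V \<union> b l) \<noteq> {}
          \<or> (V \<union> b l) \<inter> (Y \<union> {x j | j. (j, k) \<in> r \<and> j \<notin> S}) - (V \<union> b k) \<noteq> {}"
        using sep[of k l] sep[of l k] rtot[of k l] by blast
    qed
    moreover have "|K| \<le>o |L - S|"
    proof (rule ccontr)
      assume "\<not> |K| \<le>o |L - S|"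
      then have "|L - S| \<le>o |K|" using card_of_ordLeq_not ordLess_imp_ordLeq by blast
      then have "|L - S| \<le>o |Pow (Pow K)|"
        using card_of_self_Pow[of K] card_of_self_Pow[of "Pow K"] by (blast intro: ordLeq_transitive)
      moreover have "|S| \<le>o |Pow (Pow K)|" using False card_of_ordLeq_not by blast
      ultimately have "|(L - S) \<union> S| \<le>o |Pow (Pow K)|"
        using K by (intro card_of_Un_ordLeq_infinite_Field)
          (auto simp: Field_card_of card_of_card_order_on)
      then have "|L| \<le>o |Pow (Pow K)|" using card_of_mono1[of L "L - S \<union> S"] ordLeq_transitive by blast
      with L(1) show False using not_ordLess_ordLeq by blast
    qed
    ultimately show ?thesis by (rule splits_ordLeq)
  next
    case True
    \<comment> \<open>At stage \<open>k\<close> the members follow the path of \<open>W\<close> and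
      so contain all earlier \<open>x j\<close> with \<open>j\<close> in \<open>S\<close>, but they
      omit \<open>x k\<close> itself.\<close>
    define M where "M k = {W'\<in>node W k. x k \<notin> W'}" for k
    have "\<forall>k\<in>S. \<exists>G. \<forall>i\<in>K. openin Omega (G i) \<and> big {W'\<in>M k. G i \<subseteq> W'} \<and>
        (\<forall>j\<in>S. (j, k) \<in> r \<longrightarrow> (\<exists>i\<in>K. x j \<in> G i))"
    proof
      fix k assume k: "k \<in> S"
      have bigM: "big (M k)" unfolding M_def using xout k by (simp add: S_def)
      \<comment> \<open>Members including a set of \<open>Bs\<close> that only few share are thrown
        away. Every set of \<open>Bs\<close> inside a remaining \<open>W'\<close> is then included
        in many members, in particular each piece of a cover of the earlier points.\<close>
      have "small (\<Union>G\<in>{G\<in>Bs. small {W'\<in>M k. G \<subseteq> W'}}. {W'\<in>M k. G \<subseteq> W'})"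
        using small_subset[OF Bs] by (intro small_UN) auto
      with bigM have "big (M k - (\<Union>G\<in>{G\<in>Bs. small {W'\<in>M k. G \<subseteq> W'}}. {W'\<in>M k. G \<subseteq> W'}))" by (rule big_Diff)
      then obtain W' where W': "W' \<in> M k" "\<And>G. G \<in> Bs \<Longrightarrow> G \<subseteq> W' \<Longrightarrow> big {W'\<in>M k. G \<subseteq> W'}"
        using big_nonempty by blast
      define a where "a = x ` {j\<in>S. (j, k) \<in> r}"
      have "a \<subseteq> W'" using W'(1) nodex by (auto simp: a_def M_def S_def)
      moreover have "|a| \<le>o |L|" unfolding a_def
        by (rule ordLeq_transitive[OF card_of_image card_of_mono1]) (auto simp: S_def)
      moreover have "openin Omega W'" using W'(1) by (auto simp: M_def intro: op nodeF)
      ultimately obtain G where G: "\<And>i. i \<in> K \<Longrightarrow> G i \<in> Bs \<and> openin Omega (G i) \<and> G i \<subseteq> W'" "a \<subseteq> (\<Union>i\<in>K. G i)"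
        using cover[of W' a] by blast
      show "\<exists>G. \<forall>i\<in>K. openin Omega (G i) \<and> big {W'\<in>M k. G i \<subseteq> W'} \<and>
          (\<forall>j\<in>S. (j, k) \<in> r \<longrightarrow> (\<exists>i\<in>K. x j \<in> G i))"
      proof (intro exI[of _ G] ballI conjI impI)
        fix i assume i: "i \<in> K"
        show "openin Omega (G i)" using G(1)[OF i] by blast
        show "big {W'\<in>M k. G i \<subseteq> W'}"
          using G(1)[OF i] W'(2)[of "G i"] by blast
        fix j assume "j \<in> S" "(j, k) \<in> r"
        then show "\<exists>i\<in>K. x j \<in> G i" using G(2) by (auto simp: a_def)
      qed
    qed
    then obtain G where "\<forall>k\<in>S. \<forall>i\<in>K. openin Omega (G k i) \<and> big {W'\<in>M k. G k i \<subseteq> W'} \<and>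
        (\<forall>j\<in>S. (j, k) \<in> r \<longrightarrow> (\<exists>i\<in>K. x j \<in> G k i))"
      by (rule bchoice[THEN exE])
    then have G: "\<And>k i. k \<in> S \<Longrightarrow> i \<in> K \<Longrightarrow> openin Omega (G k i)"
      "\<And>k i. k \<in> S \<Longrightarrow> i \<in> K \<Longrightarrow> big {W'\<in>M k. G k i \<subseteq> W'}"
      "\<And>k j i. k \<in> S \<Longrightarrow> j \<in> S \<Longrightarrow> (j, k) \<in> r \<Longrightarrow> i \<in> K \<Longrightarrow> \<exists>i\<in>K. x j \<in> G k i" by simp_all
    have "K \<noteq> {}" using K by auto
    then have "\<forall>k j. \<exists>i. k \<in> S \<longrightarrow> j \<in> S \<longrightarrow> (j, k) \<in> r \<longrightarrow> i \<in> K \<and> x j \<in> G k i" using G(3) by blast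
    then obtain c where c: "\<And>k j. k \<in> S \<Longrightarrow> j \<in> S \<Longrightarrow> (j, k) \<in> r \<Longrightarrow> c k j \<in> K \<and> x j \<in> G k (c k j)" by metis
    \<comment> \<open>The colour of a pair is the index of the piece at the later position that
      covers the earlier point; both orders of the pair receive it.\<close>
    define f where "f j k = (if (j, k) \<in> r then c k j else c j k)" for j k
    have asym: "(j, k) \<in> r \<Longrightarrow> (k, j) \<notin> r" for j k using r(1) by (rule wf_not_sym)
    have SL: "S \<subseteq> L" by (auto simp: S_def)
    obtain H i where H: "H \<subseteq> S" "|K| \<le>o |H|" "i \<in> K"
      "\<And>j k. j \<in> H \<Longrightarrow> k \<in> H \<Longrightarrow> j \<noteq> k \<Longrightarrow> f j k = i \<or> f k j = i"
    proof (rule homogeneous_subset[OF K True, of f])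
      fix j k assume jk: "j \<in> S" "k \<in> S" "j \<noteq> k"
      then show "f j k \<in> K" using rtot[of j k] c SL by (auto simp: f_def)
    qed blast
    have xG: "x j \<in> G k i" if "j \<in> H" "k \<in> H" "(j, k) \<in> r" for j k
    proof -
      have "j \<noteq> k" using that r(1) by auto
      moreover have "f j k = c k j" "f k j = c k j" using that(3) asym by (auto simp: f_def)
      ultimately have "c k j = i" using H(4) that by metis
      then show ?thesis using c that H(1) by blast
    qed
    \<comment> \<open>With the single colour \<open>i\<close>, the piece \<open>G k i\<close>
      contains every earlier \<open>x j\<close> of \<open>H\<close>, while at \<open>j\<close> the
      point \<open>x j\<close> is required to be missing.\<close>
    have "splits H Y V"
    proof (rule splitsI[where Y' = "\<lambda>k. insert (x k) Y" and V' = "\<lambda>k. V \<union> G k i"])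
      fix k assume "k \<in> H"
      then have k: "k \<in> S" using H(1) by blast
      have sub: "W' \<in> extensions (insert (x k) Y) (V \<union> G k i) \<and> V \<union> G k i \<in> extensions Y V"
        if W': "W' \<in> {W'\<in>M k. G k i \<subseteq> W'}" for W'
      proof -
        have "W' \<in> extensions Y V" "G k i \<subseteq> W'" "x k \<notin> W'" using W' nodeF by (auto simp: F_def M_def)
        then show ?thesis using V G(1)[OF k H(3)] by (auto simp: extensions_def)
      qed
      show "Y \<subseteq> insert (x k) Y" by blast
      show "V \<union> G k i \<in> extensions Y V" using sub big_nonempty[OF G(2)[OF k H(3)]] by blast
      show "big (extensions (insert (x k) Y) (V \<union> G k i))"
        using G(2)[OF k H(3)] by (rule big_superset) (use sub in blast)
    next
      have sep: "x j \<in> (V \<union> G k i) \<inter> insert (x j) Y - (V \<union> G j i)"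
        if jk: "j \<in> H" "k \<in> H" "(j, k) \<in> r" for j k
      proof -
        have j: "j \<in> S" using jk H(1) by blast
        obtain W' where W': "W' \<in> {W'\<in>M j. G j i \<subseteq> W'}"
          using big_nonempty[OF G(2)[OF j H(3)]] by blast
        then have "W' \<in> F" "x j \<notin> W'" "G j i \<subseteq> W'" using nodeF unfolding M_def by blast+
        then have "V \<union> G j i \<subseteq> W'" by (auto simp: F_def extensions_def)
        then show ?thesis using xG[OF jk] \<open>x j \<notin> W'\<close> by auto
      qed
      fix k l assume kl: "k \<in> H" "l \<in> H" "k \<noteq> l"
      then have "(k, l) \<in> r \<or> (l, k) \<in> r" using rtot H(1) SL by blast
      then show "(V \<union> G k i) \<inter> insert (x l) Y - (V \<union> G l i) \<noteq> {} \<or> (V \<union> G l i) \<inter> insert (x k) Y - (V \<union> G k i) \<noteq> {}"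
        using sep[OF kl(1,2)] sep[OF kl(2,1)] by blast
    qed
    then show ?thesis using H(2) by (rule splits_ordLeq)
  qed
qed

end

subsection \<open>The tree of open sets\<close>

lemma card_of_UNION_nat:
  assumes "Card_order r" "infinite (Field r)" "\<And>n::nat. |A n| \<le>o r"
  shows "|\<Union>n. A n| \<le>o r"
proof (rule card_of_UNION_ordLeq_infinite_Field[OF assms(2,1)])
  have "|UNIV :: nat set| \<le>o |Field r|" using assms(2) infinite_iff_card_of_nat by blast
  then show "|UNIV :: nat set| \<le>o r" using assms(1) card_of_Field_ordIso ordLeq_ordIso_trans by blast
qed (use assms(3) in blast)

context small_base
begin

text \<open>A branch \<open>e\<close> picks a child in \<open>K n\<close> at level \<open>n\<close>,
  and \<open>W e\<close> is the union of its open sets. As \<open>W e\<close> keeps the traces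
  prescribed along the branch, the point separating the two children where branches part also
  separates the resulting sets. There are at most \<open>lam\<close> nodes and separating
  points.\<close>

lemma tree_of_extensions:
  fixes K :: "nat \<Rightarrow> 'k set" and lam :: "'l rel"
  assumes lam: "Card_order lam" "infinite (Field lam)"
    and K: "\<And>n. |K n| \<le>o lam"
    and splits: "\<And>n Y V. openin Omega V \<Longrightarrow> big (extensions Y V) \<Longrightarrow> splits (K n) Y V"
    and big: "big {U. openin Omega U}"
  obtains X0 B' W where "X0 \<subseteq> topspace Omega" "|X0| \<le>o lam"
    "B' \<subseteq> {U. openin Omega U}" "|B'| \<le>o lam"
    "\<forall>e\<in>Pi UNIV K. \<exists>F\<subseteq>B'. W e = \<Union>F"
    "inj_on (\<lambda>e. W e \<inter> X0) (Pi UNIV K)"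
proof -
  define good where "good c \<longleftrightarrow> openin Omega (snd c) \<and> big (extensions (fst c) (snd c))" for c :: "'p set \<times> 'p set"
  define le where "le c d \<longleftrightarrow> fst c \<subseteq> fst d \<and> snd d \<in> extensions (fst c) (snd c)" for c d :: "'p set \<times> 'p set"
  define sep where "sep c d x \<longleftrightarrow> x \<in> snd c \<inter> fst d - snd d \<or> x \<in> snd d \<inter> fst c - snd c" for c d :: "'p set \<times> 'p set" and x
  define ok where "ok n c E \<longleftrightarrow> (\<forall>k\<in>K n. good (E k) \<and> le c (E k)) \<and>
      (\<forall>k\<in>K n. \<forall>l\<in>K n. k \<noteq> l \<longrightarrow> (\<exists>x. sep (E k) (E l) x))" for n c and E :: "'k \<Rightarrow> 'p set \<times> 'p set"
  have ex_ok: "\<exists>E. ok n c E" if "good c" for n c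
  proof -
    have "splits (K n) (fst c) (snd c)" using splits that by (simp add: good_def)
    then obtain Y' V' where
      1: "\<forall>k\<in>K n. fst c \<subseteq> Y' k \<and> V' k \<in> extensions (fst c) (snd c) \<and> big (extensions (Y' k) (V' k))"
      and 2: "\<forall>k\<in>K n. \<forall>l\<in>K n. k \<noteq> l \<longrightarrow> V' k \<inter> Y' l - V' l \<noteq> {} \<or> V' l \<inter> Y' k - V' k \<noteq> {}"
      unfolding splits_def by (elim exE conjE)
    have "ok n c (\<lambda>k. (Y' k, V' k))" unfolding ok_def
    proof (intro impI conjI ballI)
      fix k assume k: "k \<in> K n"
      from 1[THEN bspec, OF k] show "good (Y' k, V' k)" "le c (Y' k, V' k)"
        by (auto simp: good_def le_def extensions_def)
    next
      fix k l assume "k \<in> K n" "l \<in> K n" "k \<noteq> l"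
      then have "V' k \<inter> Y' l - V' l \<noteq> {} \<or> V' l \<inter> Y' k - V' k \<noteq> {}" using 2 by blast
      then show "\<exists>x. sep (Y' k, V' k) (Y' l, V' l) x" unfolding sep_def fst_conv snd_conv by blast
    qed
    then show ?thesis by blast
  qed
  define E where "E n c = (SOME E. ok n c E)" for n c
  have "ok n c (E n c)" if "good c" for n c
    unfolding E_def by (rule someI_ex[OF ex_ok[OF that]])
  then have E: "\<And>n c k. good c \<Longrightarrow> k \<in> K n \<Longrightarrow> good (E n c k)"
    "\<And>n c k. good c \<Longrightarrow> k \<in> K n \<Longrightarrow> le c (E n c k)"
    "\<And>n c k l. good c \<Longrightarrow> k \<in> K n \<Longrightarrow> l \<in> K n \<Longrightarrow> k \<noteq> l \<Longrightarrow> \<exists>x. sep (E n c k) (E n c l) x"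
    unfolding ok_def by simp_all
  define pt where "pt n c kl = (SOME x. sep (E n c (fst kl)) (E n c (snd kl)) x)" for n c kl
  have pt: "sep (E n c k) (E n c l) (pt n c (k, l))" if "good c" "k \<in> K n" "l \<in> K n" "k \<noteq> l" for n c k l
    unfolding pt_def fst_conv snd_conv by (rule someI_ex[OF E(3)[OF that]])
  \<comment> \<open>At the root nothing is prescribed, so its extensions are all open sets.\<close>
  define nodes where "nodes = rec_nat {({}, {})} (\<lambda>n N. \<Union>c\<in>N. E n c ` K n)"
  have nodes: "nodes 0 = {({}, {})}" "nodes (Suc n) = (\<Union>c\<in>nodes n. E n c ` K n)" for n
    by (simp_all add: nodes_def)
  define branch where "branch e = rec_nat ({}, {}) (\<lambda>n c. E n c (e n))" for e
  have branch: "branch e 0 = ({}, {})" "branch e (Suc n) = E n (branch e n) (e n)" for e n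
    by (simp_all add: branch_def)
  have good_nodes: "good c" if "c \<in> nodes n" for c n
    using that
  proof (induction n arbitrary: c)
    case 0
    have "extensions {} {} = {U. openin Omega U}" by (auto simp: extensions_def)
    then show ?case using 0 big by (simp add: nodes good_def)
  next
    case (Suc n)
    then show ?case using E(1) by (auto simp: nodes)
  qed
  have branch_nodes: "branch e n \<in> nodes n" if "e \<in> Pi UNIV K" for e n
    using that by (induction n) (auto simp: branch nodes)
  have card_nodes: "|nodes n| \<le>o lam" for n
  proof (induction n)
    case 0
    show ?case unfolding nodes using lam by (intro Card_order_singl_ordLeq) auto
  next
    case (Suc n)
    show ?case unfolding nodes
      by (intro card_of_UNION_ordLeq_infinite_Field[OF lam(2,1) Suc] ballI ordLeq_transitive[OF card_of_image K])
  qed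
  define B' where "B' = (\<Union>n. snd ` nodes n)"
  \<comment> \<open>For a pair \<open>(k, k)\<close> no separating point exists and
    \<open>pt\<close> is arbitrary, hence the intersection with the space. A genuine separating
    point lies in an open set and survives.\<close>
  define X0 where "X0 = (\<Union>n. \<Union>c\<in>nodes n. pt n c ` (K n \<times> K n)) \<inter> topspace Omega"
  define W where "W e = (\<Union>n. snd (branch e n))" for e
  have le_trans: "le c d'" if "le c d" "le d d'" for c d d'
    using that by (auto simp: le_def extensions_def)
  have branch_le: "le (branch e n) (branch e m)" if e: "e \<in> Pi UNIV K" and "n \<le> m" for e n m
    using that(2)
  proof (induction m rule: dec_induct)
    case base
    have "good (branch e n)" using good_nodes branch_nodes e by blast
    then show ?case by (auto simp: le_def good_def extensions_def)
  next
    case (step m)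
    have "le (branch e m) (branch e (Suc m))"
      unfolding branch using E(2) good_nodes branch_nodes e by blast
    with step.IH show ?case by (rule le_trans)
  qed
  \<comment> \<open>Later nodes of the branch preserve the trace on \<open>fst (branch e n)\<close>,
    so the union does too.\<close>
  have W_branch: "snd (branch e n) \<subseteq> W e" "W e \<inter> fst (branch e n) \<subseteq> snd (branch e n)"
    if e: "e \<in> Pi UNIV K" for e n
  proof -
    show "snd (branch e n) \<subseteq> W e" by (auto simp: W_def)
    show "W e \<inter> fst (branch e n) \<subseteq> snd (branch e n)"
    proof
      fix x assume x: "x \<in> W e \<inter> fst (branch e n)"
      then obtain m where "x \<in> snd (branch e m)" by (auto simp: W_def)
      moreover have "le (branch e n) (branch e (max n m))" "le (branch e m) (branch e (max n m))"
        using branch_le[OF e] by simp_all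
      ultimately show "x \<in> snd (branch e n)" using x by (auto simp: le_def extensions_def)
    qed
  qed
  show thesis
  proof (rule that[of X0 B' W])
    show "X0 \<subseteq> topspace Omega" by (simp add: X0_def)
    have KK: "|K n \<times> K n| \<le>o lam" for n
      using card_of_Times_ordLeq_infinite_Field[OF lam(2) K K lam(1)] .
    have "|\<Union>n. \<Union>c\<in>nodes n. pt n c ` (K n \<times> K n)| \<le>o lam"
    proof (rule card_of_UNION_nat[OF lam])
      fix n
      show "|\<Union>c\<in>nodes n. pt n c ` (K n \<times> K n)| \<le>o lam"
        by (intro card_of_UNION_ordLeq_infinite_Field[OF lam(2,1) card_nodes] ballI ordLeq_transitive[OF card_of_image KK])
    qed
    then show "|X0| \<le>o lam" unfolding X0_def by (rule ordLeq_transitive[OF card_of_mono1[OF Int_lower1]])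
    show "B' \<subseteq> {U. openin Omega U}" using good_nodes by (auto simp: B'_def good_def)
    show "|B'| \<le>o lam" unfolding B'_def
      by (intro card_of_UNION_nat[OF lam] ordLeq_transitive[OF card_of_image card_nodes])
    show "\<forall>e\<in>Pi UNIV K. \<exists>F\<subseteq>B'. W e = \<Union>F"
    proof
      fix e assume e: "e \<in> Pi UNIV K"
      show "\<exists>F\<subseteq>B'. W e = \<Union>F"
        using branch_nodes[OF e] by (intro exI[of _ "range (\<lambda>n. snd (branch e n))"]) (auto simp: B'_def W_def)
    qed
    show "inj_on (\<lambda>e. W e \<inter> X0) (Pi UNIV K)"
    proof (rule inj_onI, rule ccontr)
      fix e e' assume e: "e \<in> Pi UNIV K" and e': "e' \<in> Pi UNIV K" and eq: "W e \<inter> X0 = W e' \<inter> X0" and "e \<noteq> e'"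
      then obtain m where "e m \<noteq> e' m" by blast
      then obtain n where n: "e n \<noteq> e' n" "\<And>i. i < n \<Longrightarrow> e i = e' i"
        using exists_least_iff[of "\<lambda>m. e m \<noteq> e' m"] by blast
      have same: "i \<le> n \<Longrightarrow> branch e i = branch e' i" for i
        using n(2) by (induction i) (simp_all add: branch)
      define c where "c = branch e n"
      have c: "c \<in> nodes n" "good c" unfolding c_def using branch_nodes[OF e] good_nodes by blast+
      have K': "e n \<in> K n" "e' n \<in> K n" using e e' by auto
      define x where "x = pt n c (e n, e' n)"
      have "sep (branch e (Suc n)) (branch e' (Suc n)) x"
        using pt[OF c(2) K' n(1)] by (simp add: branch same[of n, symmetric] c_def x_def)
      moreover have "x \<in> X0" if "x \<in> snd (branch e (Suc n)) \<union> snd (branch e' (Suc n))"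
      proof -
        have "good (branch e (Suc n))" "good (branch e' (Suc n))"
          using branch_nodes e e' good_nodes by blast+
        then have "x \<in> topspace Omega" using that openin_subset by (fastforce simp: good_def)
        then show ?thesis using c(1) K' by (auto simp: X0_def x_def)
      qed
      ultimately show False
        using eq W_branch[OF e, of "Suc n"] W_branch[OF e', of "Suc n"] unfolding sep_def by blast
    qed
  qed
qed

end

subsection \<open>The dichotomy\<close>

lemma ctwo_cexp_Pow: "ctwo ^c r =o |Pow (Field r)|"
  using card_of_Pow_Func[of "Field r"] by (simp add: cexp_def ctwo_def Field_card_of ordIso_symmetric)

text \<open>A subset of the disjoint sum is coded by the sequence of its sections: \<open>2\<close>
  to a sum is the product of the powers.\<close>

lemma Pow_Sigma_ordLeq_Pi:
  assumes "\<And>n::nat. |Pow (L n)| \<le>o |K n|"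
  shows "|Pow (SIGMA n:UNIV. L n)| \<le>o |Pi UNIV K|"
proof -
  have "\<forall>n. \<exists>h. inj_on h (Pow (L n)) \<and> h ` Pow (L n) \<subseteq> K n"
    using assms unfolding card_of_ordLeq[symmetric] by blast
  then obtain h where "\<forall>n. inj_on (h n) (Pow (L n)) \<and> h n ` Pow (L n) \<subseteq> K n" by (rule choice[THEN exE])
  then have h: "inj_on (h n) (Pow (L n))" "h n ` Pow (L n) \<subseteq> K n" for n by simp_all
  have sub: "A `` {n} \<in> Pow (L n)" if "A \<subseteq> (SIGMA n:UNIV. L n)" for A n using that by auto
  have "inj_on (\<lambda>A n. h n (A `` {n})) (Pow (SIGMA n:UNIV. L n))"
  proof (rule inj_onI)
    fix A A' assume A: "A \<in> Pow (SIGMA n:UNIV. L n)" "A' \<in> Pow (SIGMA n:UNIV. L n)"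
      and eq: "(\<lambda>n. h n (A `` {n})) = (\<lambda>n. h n (A' `` {n}))"
    have "A `` {n} = A' `` {n}" for n
      using inj_onD[OF h(1) fun_cong[OF eq, of n]] sub A by blast
    then show "A = A'" by auto
  qed
  moreover have "(\<lambda>A n. h n (A `` {n})) ` Pow (SIGMA n:UNIV. L n) \<subseteq> Pi UNIV K"
  proof (rule image_subsetI, rule Pi_I)
    fix A n assume "A \<in> Pow (SIGMA n:UNIV. L n)"
    then have "A `` {n} \<in> Pow (L n)" using sub by blast
    then show "h n (A `` {n}) \<in> K n" using h(2) by blast
  qed
  ultimately show ?thesis unfolding card_of_ordLeq[symmetric] by blast
qed

lemma Csum_natLeq: "BNF_Cardinal_Arithmetic.Csum natLeq rs = |SIGMA n:UNIV. Field (rs n)|"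
  by (simp add: Csum_def Field_natLeq)

context small_base
begin

text \<open>Numbering \<open>B\<close> inside \<open>mu\<close> turns a choice of basic
  neighbourhoods for \<open>a\<close> into a set of at most \<open>nu\<close> codes, which is
  covered by at most \<open>kappa\<close> members of a covering family. \<open>Bs\<close> consists
  of the unions of basic sets coded by subsets of such members; it is small because each member has
  at most \<open>mu\<close> subsets.\<close>

lemma cover_by_small_family:
  assumes nu: "Card_order nu" "small (Pow (Field nu))" and kappa: "Card_order kappa"
    and cov: "cov mu nu (cardSuc kappa) \<le>o mu"
  obtains Bs where "small Bs"
    "\<And>W a. openin Omega W \<Longrightarrow> a \<subseteq> W \<Longrightarrow> |a| \<le>o nu \<Longrightarrow>
      \<exists>G. (\<forall>i\<in>Field kappa. G i \<in> Bs \<and> openin Omega (G i) \<and> G i \<subseteq> W) \<and> a \<subseteq> (\<Union>i\<in>Field kappa. G i)"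
proof -
  obtain P where P: "cov_family mu nu (cardSuc kappa) P" "|P| \<le>o mu"
    using cov cov_le_iff[OF Card_order_mu] by blast
  have "|B| \<le>o |Field mu|"
    using small_B card_of_Field_ordIso[OF Card_order_mu] ordIso_symmetric ordLeq_ordIso_trans by blast
  then obtain h where h: "inj_on h B" "h ` B \<subseteq> Field mu" unfolding card_of_ordLeq[symmetric] by blast
  define g where "g q = \<Union>{b\<in>B. h b \<in> q}" for q
  define Bs where "Bs = g ` insert {} (\<Union>p\<in>P. Pow p)"
  have op_g: "openin Omega (g q)" for q unfolding g_def using openin_B by blast
  show thesis
  proof (rule that[of Bs])
    have "small (Pow p)" if "p \<in> P" for p
    proof -
      have "|p| \<le>o nu" using that P(1) by (simp add: cov_family_def)
      then have "|p| \<le>o |Field nu|"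
        using card_of_Field_ordIso[OF nu(1)] ordIso_symmetric ordLeq_ordIso_trans by blast
      then show ?thesis using nu(2) by (rule small_ordLeq[OF card_of_Pow_mono])
    qed
    then have "small (\<Union>p\<in>P. Pow p)" using P(2) by (intro small_UN) (simp add: small_def)
    then have "small (insert {} (\<Union>p\<in>P. Pow p))"
      using small_Un[OF small_finite[of "{{}}"]] by simp
    then show "small Bs" unfolding Bs_def by (rule small_image)
    fix W a assume W: "openin Omega W" and a: "a \<subseteq> W" "|a| \<le>o nu"
    have "\<forall>x\<in>a. \<exists>b. b \<in> B \<and> x \<in> b \<and> b \<subseteq> W" using base[OF W] a(1) by blast
    then obtain bb where "\<forall>x\<in>a. bb x \<in> B \<and> x \<in> bb x \<and> bb x \<subseteq> W" by (rule bchoice[THEN exE])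
    then have bb: "bb x \<in> B" "x \<in> bb x" "bb x \<subseteq> W" if "x \<in> a" for x using that by simp_all
    define s where "s = (\<lambda>x. h (bb x)) ` a"
    have "s \<subseteq> Field mu" using bb(1) h(2) by (auto simp: s_def)
    moreover have "|s| \<le>o nu" unfolding s_def by (rule ordLeq_transitive[OF card_of_image a(2)])
    ultimately obtain \<alpha> f where f: "\<alpha> \<in> Field (cardSuc kappa)"
      "\<And>i. i \<in> underS (cardSuc kappa) \<alpha> \<Longrightarrow> f i \<in> P" "s \<subseteq> (\<Union>i\<in>underS (cardSuc kappa) \<alpha>. f i)"
      using P(1) unfolding cov_family_def by metis
    \<comment> \<open>An ordinal below the successor of \<open>kappa\<close> has at most
      \<open>kappa\<close> predecessors, so the pieces can be reindexed by
      \<open>Field kappa\<close>.\<close>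
    define I where "I = underS (cardSuc kappa) \<alpha>"
    have "|I| <o cardSuc kappa" unfolding I_def
      using cardSuc_Card_order[OF kappa] f(1) by (rule card_of_underS)
    then have "|I| \<le>o kappa" using cardSuc_ordLeq_ordLess[OF kappa] card_of_Card_order by blast
    then have "|I| \<le>o |Field kappa|"
      using card_of_Field_ordIso[OF kappa] ordIso_symmetric ordLeq_ordIso_trans by blast
    then obtain e where e: "inj_on e I" "e ` I \<subseteq> Field kappa" unfolding card_of_ordLeq[symmetric] by blast
    define G where "G i = g (if i \<in> e ` I then f (inv_into I e i) \<inter> s else {})" for i
    show "\<exists>G. (\<forall>i\<in>Field kappa. G i \<in> Bs \<and> openin Omega (G i) \<and> G i \<subseteq> W) \<and> a \<subseteq> (\<Union>i\<in>Field kappa. G i)"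
    proof (intro exI[of _ G] conjI ballI)
      fix i
      show "G i \<in> Bs"
      proof (cases "i \<in> e ` I")
        case True
        then have "f (inv_into I e i) \<in> P" using f(2) inv_into_into[of i e I] unfolding I_def by blast
        then show ?thesis using True unfolding G_def Bs_def by auto
      qed (simp add: G_def Bs_def)
      show "openin Omega (G i)" unfolding G_def by (rule op_g)
      show "G i \<subseteq> W"
      proof
        fix y assume "y \<in> G i"
        then obtain b where b: "b \<in> B" "y \<in> b" "h b \<in> s" by (auto simp: G_def g_def split: if_splits)
        then obtain x where "x \<in> a" "h b = h (bb x)" by (auto simp: s_def)
        then have "b = bb x" using h(1) b(1) bb(1) by (auto dest: inj_onD)
        then show "y \<in> W" using bb(3) \<open>x \<in> a\<close> b(2) by blast
      qed
    next
      show "a \<subseteq> (\<Union>i\<in>Field kappa. G i)"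
      proof
        fix x assume x: "x \<in> a"
        then have s: "h (bb x) \<in> s" by (simp add: s_def)
        then obtain i where i: "i \<in> I" "h (bb x) \<in> f i" using f(3) unfolding I_def by blast
        then have "x \<in> G (e i)" using bb[OF x] s e(1) by (auto simp: G_def g_def)
        then show "x \<in> (\<Union>i\<in>Field kappa. G i)" using i(1) e(2) by blast
      qed
    qed
  qed
qed

text \<open>The bound on \<open>X0\<close> allows at most \<open>2\<close> to the \<open>lam\<close>
  traces, and the branches provide that many. If \<open>X0\<close> or \<open>B'\<close> were smaller
  than \<open>lam\<close>, there would be at most \<open>lam\<close> traces by \<open>limit\<close>.
  This strong limit property is assumed once for sets of points and once for families of them,
  because an assumption is tied to one type.\<close>

lemma many_traces:
  fixes K :: "nat \<Rightarrow> 'k set" and lam :: "'l rel"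
  assumes lam: "Card_order lam" "infinite (Field lam)"
    and limit: "\<And>X :: 'p set. |X| <o lam \<Longrightarrow> |Pow X| \<le>o lam" "\<And>X :: 'p set set. |X| <o lam \<Longrightarrow> |Pow X| \<le>o lam"
    and K: "\<And>n. |K n| \<le>o lam" "|Pow (Field lam)| \<le>o |Pi UNIV K|"
    and splits: "\<And>n Y V. openin Omega V \<Longrightarrow> big (extensions Y V) \<Longrightarrow> splits (K n) Y V"
    and big: "big {U. openin Omega U}"
  shows "\<exists>X0. X0 \<subseteq> topspace Omega \<and> |X0| =o lam
          \<and> |{U \<inter> X0 | U. openin Omega U}| =o ctwo ^c lam
          \<and> (\<exists>B'. B' \<subseteq> {U. openin Omega U} \<and> |B'| =o lam
                \<and> |{X0 \<inter> U | U. \<exists>F\<subseteq>B'. U = \<Union>F}| =o ctwo ^c lam)"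
proof -
  obtain X0 B' W where X0: "X0 \<subseteq> topspace Omega" "|X0| \<le>o lam"
    and B': "B' \<subseteq> {U. openin Omega U}" "|B'| \<le>o lam"
    and W: "\<forall>e\<in>Pi UNIV K. \<exists>F\<subseteq>B'. W e = \<Union>F" "inj_on (\<lambda>e. W e \<inter> X0) (Pi UNIV K)"
    by (rule tree_of_extensions[OF lam, of K, OF K(1) splits big])
  define Tr where "Tr = {X0 \<inter> U | U. \<exists>F\<subseteq>B'. U = \<Union>F}"
  define Tr' where "Tr' = {U \<inter> X0 | U. openin Omega U}"
  have "(\<lambda>e. W e \<inter> X0) ` Pi UNIV K \<subseteq> Tr"
  proof (rule image_subsetI)
    fix e assume "e \<in> Pi UNIV K"
    with W(1) have "\<exists>F\<subseteq>B'. W e = \<Union>F" by (rule bspec)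
    then show "W e \<inter> X0 \<in> Tr"
      unfolding Tr_def by (intro CollectI exI[of _ "W e"] conjI Int_commute)
  qed
  then have "|Pi UNIV K| \<le>o |Tr|" using W(2) unfolding card_of_ordLeq[symmetric] by blast
  with K(2) have low: "|Pow (Field lam)| \<le>o |Tr|" by (rule ordLeq_transitive)
  have "openin Omega (\<Union>F)" if "F \<subseteq> B'" for F using B'(1) that by blast
  then have "Tr \<subseteq> Tr'" unfolding Tr_def Tr'_def by blast
  then have TrTr': "|Tr| \<le>o |Tr'|" by (rule card_of_mono1)
  have "Tr' \<subseteq> Pow X0" unfolding Tr'_def by blast
  then have Tr'X: "|Tr'| \<le>o |Pow X0|" by (rule card_of_mono1)
  have lamF: "lam =o |Field lam|" using card_of_Field_ordIso[OF lam(1)] by (rule ordIso_symmetric)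
  have XP: "|Pow X0| \<le>o |Pow (Field lam)|"
    by (rule card_of_Pow_mono[OF ordLeq_ordIso_trans[OF X0(2) lamF]])
  have two: "|Pow (Field lam)| =o ctwo ^c lam" by (rule ordIso_symmetric[OF ctwo_cexp_Pow])
  have "Tr \<subseteq> (\<lambda>F. X0 \<inter> \<Union>F) ` Pow B'" unfolding Tr_def by blast
  then have TrB: "|Tr| \<le>o |Pow B'|" by (rule surj_imp_ordLeq)
  have lam_small: "\<not> |Pow (Field lam)| \<le>o lam"
  proof
    assume "|Pow (Field lam)| \<le>o lam"
    then have "|Pow (Field lam)| \<le>o |Field lam|" using lamF by (rule ordLeq_ordIso_trans)
    then show False using card_of_Pow not_ordLess_ordLeq by blast
  qed
  have "|X0| =o lam"
  proof (rule ccontr)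
    assume "\<not> |X0| =o lam"
    with X0(2) have "|Pow X0| \<le>o lam" using limit(1) ordLeq_iff_ordLess_or_ordIso by blast
    then show False using lam_small low TrTr' Tr'X by (blast intro: ordLeq_transitive)
  qed
  moreover have "|B'| =o lam"
  proof (rule ccontr)
    assume "\<not> |B'| =o lam"
    with B'(2) have "|Pow B'| \<le>o lam" using limit(2) ordLeq_iff_ordLess_or_ordIso by blast
    then show False using lam_small low TrB by (blast intro: ordLeq_transitive)
  qed
  moreover have "|Tr'| =o |Pow (Field lam)|" unfolding ordIso_iff_ordLeq
    using low TrTr' Tr'X XP by (blast intro: ordLeq_transitive)
  then have "|Tr'| =o ctwo ^c lam" using two by (rule ordIso_transitive)
  moreover have "|Tr| =o |Pow (Field lam)|" unfolding ordIso_iff_ordLeq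
    using low TrTr' Tr'X XP by (blast intro: ordLeq_transitive)
  then have "|Tr| =o ctwo ^c lam" using two by (rule ordIso_transitive)
  ultimately show ?thesis using X0(1) B'(1) unfolding Tr_def Tr'_def by blast
qed

end

theorem theorem2:
  fixes lambdas :: "nat \<Rightarrow> 'l rel" and lambda :: "'a rel"
    and mus :: "nat \<Rightarrow> 'm rel" and mu :: "'b rel"
    and Omega :: "'p topology" and B :: "'p set set"
  assumes "\<And>n. Card_order (lambdas n)"
    and "\<And>n. (cinfinite (lambdas n) \<and> regularCard (lambdas n)) \<or> BNF_Cardinal_Arithmetic.cfinite (lambdas n)"
    and "\<And>n. ctwo ^c lambdas n <o lambdas (Suc n)"
    and "Card_order lambda"
    and "lambda =o BNF_Cardinal_Arithmetic.Csum natLeq lambdas"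
    and "\<And>n. Card_order (mus n)"
    and "lambda =o BNF_Cardinal_Arithmetic.Csum natLeq mus"
    and "\<And>n. lambdas n \<le>o mus (Suc n)"
    and "\<And>n. beth3 (mus n) <o lambdas n"
    and "Card_order mu"
    and "lambda \<le>o mu"
    and "mu <o lambda ^c natLeq"
    and "\<And>n. cov mu (lambdas n) (cardSuc (mus n)) \<le>o mu"
    and "base_of Omega B"
    and "|B| \<le>o mu"
  shows "lambda ^c natLeq =o ctwo ^c lambda
    \<and> (lambda ^c natLeq \<le>o |{U. openin Omega U}| \<or> |{U. openin Omega U}| \<le>o mu)
    \<and> (mu <o |{U. openin Omega U}| \<longrightarrow>
        (\<exists>X0. X0 \<subseteq> topspace Omega \<and> |X0| =o lambda
          \<and> |{U \<inter> X0 | U. openin Omega U}| =o ctwo ^c lambda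
          \<and> (\<exists>B'. B' \<subseteq> {U. openin Omega U} \<and> |B'| =o lambda
                \<and> |{X0 \<inter> U | U. \<exists>F\<subseteq>B'. U = \<Union>F}| =o ctwo ^c lambda)))"
proof -

  \<comment> \<open>Arithmetic of the given cardinals\<close>
  define L where "L n = Field (lambdas n)" for n
  define M where "M n = Field (mus n)" for n
  have L: "|L n| =o lambdas n" for n unfolding L_def by (rule card_of_Field_ordIso[OF assms(1)])
  have M: "|M n| =o mus n" for n unfolding M_def by (rule card_of_Field_ordIso[OF assms(6)])
  have lamF: "|Field lambda| =o lambda" by (rule card_of_Field_ordIso[OF assms(4)])
  have lamS: "lambda =o |SIGMA n:UNIV. L n|" using assms(5) by (simp add: Csum_natLeq L_def)
  have lamSM: "lambda =o |SIGMA n:UNIV. M n|" using assms(7) by (simp add: Csum_natLeq M_def)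
  have PowL: "|Pow (L n)| <o lambdas (Suc n)" for n
    using ordIso_ordLess_trans[OF ordIso_symmetric[OF ctwo_cexp_Pow] assms(3)] unfolding L_def .
  have "lambdas n <o lambdas (Suc n)" for n
    using ordIso_ordLess_trans[OF ordIso_symmetric[OF L] ordLess_transitive[OF card_of_Pow PowL]] .
  then have step: "|L n| \<le>o |L (Suc n)|" for n
    unfolding L_def by (intro card_of_mono2 ordLess_imp_ordLeq)
  have Lmono: "|L n| \<le>o |L m|" if "n \<le> m" for n m
    using that
  proof (induction m rule: dec_induct)
    case base
    show ?case by (rule card_of_mono1) simp
  next
    case (step m)
    show ?case by (rule ordLeq_transitive[OF step.IH \<open>\<And>n. |L n| \<le>o |L (Suc n)|\<close>])
  qed
  have Sig: "|A n| \<le>o |SIGMA n:UNIV. A n|" for A :: "nat \<Rightarrow> 'x set" and n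
    unfolding card_of_ordLeq[symmetric] by (intro exI[of _ "Pair n"]) (auto simp: inj_on_def)
  have Llam: "|L n| \<le>o lambda" for n by (rule ordLeq_ordIso_trans[OF Sig ordIso_symmetric[OF lamS]])
  have Mlam: "|M n| \<le>o lambda" for n by (rule ordLeq_ordIso_trans[OF Sig ordIso_symmetric[OF lamSM]])
  have PowLL: "|Pow (L n)| \<le>o |L (Suc n)|" for n
    by (rule ordLeq_ordIso_trans[OF ordLess_imp_ordLeq[OF PowL] ordIso_symmetric[OF L]])
  have PowLlam: "|Pow (L n)| \<le>o lambda" for n by (rule ordLeq_transitive[OF PowLL Llam])
  \<comment> \<open>A power set is nonempty, so every \<open>L (Suc n)\<close> is; infinitely many
    nonempty summands make \<open>lambda\<close> infinite.\<close>
  have Lne: "L (Suc n) \<noteq> {}" for n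
    using PowLL[of n] card_of_empty3[of "Pow (L n)"] Pow_not_empty[of "L n"] by auto
  have "infinite (SIGMA n:UNIV. L n)"
  proof
    assume "finite (SIGMA n:UNIV. L n)"
    then have "finite (fst ` (SIGMA n:UNIV. L n))" by simp
    moreover have "range Suc \<subseteq> fst ` (SIGMA n:UNIV. L n)" using Lne by force
    ultimately have "finite (range Suc)" using finite_subset by blast
    then show False using finite_imageD[of Suc UNIV] by simp
  qed
  then have inf_lam: "infinite (Field lambda)"
    using card_of_ordIso_finite[OF ordIso_transitive[OF lamF lamS]] by blast
  have "|Field lambda| \<le>o |Field mu|" by (rule card_of_mono2[OF assms(11)])
  then have inf_mu: "infinite (Field mu)" using inf_lam card_of_ordLeq_infinite by blast
  interpret small_base mu Omega B
  proof
    show "Card_order mu" "infinite (Field mu)" "|B| \<le>o mu" by fact+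
    show "openin Omega b" if "b \<in> B" for b using assms(14) that by (auto simp: base_of_def)
    show "\<exists>b\<in>B. x \<in> b \<and> b \<subseteq> U" if "openin Omega U" "x \<in> U" for U x
    proof -
      have "\<exists>F\<subseteq>B. U = \<Union>F" using assms(14) that(1) by (simp add: base_of_def)
      then show ?thesis using that(2) by blast
    qed
  qed
  have smallL: "small (Pow (L n))" for n unfolding small_def by (rule ordLeq_transitive[OF PowLlam assms(11)])
  \<comment> \<open>\<open>lambda\<close> is a strong limit: a set smaller than
    \<open>lambda\<close> embeds into some \<open>L n\<close>, since otherwise all
    \<open>L n\<close> embed into it. For a finite set this contradicts their strictly increasing
    sizes; an infinite one would be at least as large as the sum.\<close>
  have limit: "|Pow X| \<le>o lambda" if X: "|X| <o lambda" for X :: "'x set"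
  proof -
    have "\<exists>n. |X| \<le>o |L n|"
    proof (rule ccontr)
      assume "\<not> ?thesis"
      then have LX: "|L n| \<le>o |X|" for n using card_of_ordLeq_not ordLess_imp_ordLeq by blast
      show False
      proof (cases "finite X")
        case True
        have le: "card A \<le> card A'" if "|A| \<le>o |A'|" "finite A'" for A :: "'u set" and A' :: "'v set"
          using that card_inj_on_le unfolding card_of_ordLeq[symmetric] by blast
        have fin: "finite (L n)" for n using LX True card_of_ordLeq_finite by blast
        have "card (L n) < card (L (Suc n))" for n
        proof -
          have "card (L n) < card (Pow (L n))" using fin by (simp add: card_Pow)
          also have "\<dots> \<le> card (L (Suc n))" by (rule le[OF PowLL fin])
          finally show ?thesis .
        qed
        then have "strict_mono (\<lambda>n. card (L n))" by (simp add: strict_mono_Suc_iff)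
        then have "Suc (card X) \<le> card (L (Suc (card X)))" by (rule strict_mono_imp_increasing)
        moreover have "card (L (Suc (card X))) \<le> card X"
          by (rule le[OF LX True])
        ultimately show False by simp
      next
        case False
        then have "|UNIV :: nat set| \<le>o |X|" using infinite_iff_card_of_nat by blast
        then have "|SIGMA n:UNIV. L n| \<le>o |X|"
          using False LX by (intro card_of_Sigma_ordLeq_infinite) auto
        with lamS have "lambda \<le>o |X|" by (rule ordIso_ordLeq_trans)
        with X show False using not_ordLess_ordLeq by blast
      qed
    qed
    then obtain n where "|X| \<le>o |L n|" by blast
    then show ?thesis using ordLeq_transitive[OF card_of_Pow_mono PowLlam] by blast
  qed
  have lamSP: "|Pow (Field lambda)| \<le>o |Pow (SIGMA n:UNIV. L n)|"
    by (rule card_of_Pow_mono[OF ordIso_imp_ordLeq[OF ordIso_transitive[OF lamF lamS]]])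
  \<comment> \<open>Upper bound: \<open>lambda\<close> is at most \<open>2\<close> to the
    \<open>lambda\<close>, whose countable power is itself. Lower bound: a subset of the sum is
    coded by countably many sections, each from a power set of size at most
    \<open>lambda\<close>.\<close>
  have power: "lambda ^c natLeq =o ctwo ^c lambda"
  proof -
    have Cinf: "Cinfinite lambda" using inf_lam assms(4) by (simp add: cinfinite_def)
    have "lambda \<le>o ctwo ^c lambda" by (rule ordLess_imp_ordLeq[OF ordLess_ctwo_cexp[OF assms(4)]])
    then have "lambda ^c natLeq \<le>o (ctwo ^c lambda) ^c natLeq"
      by (rule cexp_mono1[OF _ natLeq_Card_order])
    moreover have "(ctwo ^c lambda) ^c natLeq =o ctwo ^c (lambda *c natLeq)"
      by (rule cexp_cprod[OF Card_order_ctwo])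
    moreover have "ctwo ^c (lambda *c natLeq) =o ctwo ^c lambda"
      by (rule cexp_cong2[OF cprod_infinite1'[OF Cinf Cinfinite_Cnotzero[OF natLeq_Cinfinite] natLeq_ordLeq_cinfinite[OF Cinf]]
        Card_order_ctwo Card_order_cprod])
    ultimately have "lambda ^c natLeq \<le>o ctwo ^c lambda"
      using ordLeq_ordIso_trans ordIso_transitive by blast
    moreover have "ctwo ^c lambda \<le>o lambda ^c natLeq"
    proof -
      have "|Pow (L n)| \<le>o |Field lambda|" for n
        by (rule ordLeq_ordIso_trans[OF PowLlam ordIso_symmetric[OF lamF]])
      then have "|Pow (SIGMA n:UNIV. L n)| \<le>o |Pi UNIV (\<lambda>_::nat. Field lambda)|"
        by (rule Pow_Sigma_ordLeq_Pi)
      also have "Pi UNIV (\<lambda>_::nat. Field lambda) = Func (Field natLeq) (Field lambda)"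
        by (auto simp: Field_natLeq Func_def)
      finally have "|Pow (Field lambda)| \<le>o lambda ^c natLeq"
        unfolding cexp_def by (rule ordLeq_transitive[OF lamSP])
      then show ?thesis by (rule ordIso_ordLeq_trans[OF ctwo_cexp_Pow])
    qed
    ultimately show ?thesis unfolding ordIso_iff_ordLeq by blast
  qed

  \<comment> \<open>Traces of a topology with more than \<open>mu\<close> open sets\<close>
  have traces: "\<exists>X0. X0 \<subseteq> topspace Omega \<and> |X0| =o lambda
          \<and> |{U \<inter> X0 | U. openin Omega U}| =o ctwo ^c lambda
          \<and> (\<exists>B'. B' \<subseteq> {U. openin Omega U} \<and> |B'| =o lambda
                \<and> |{X0 \<inter> U | U. \<exists>F\<subseteq>B'. U = \<Union>F}| =o ctwo ^c lambda)"
    if bigT: "\<not> |{U. openin Omega U}| \<le>o mu"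
  proof (cases "\<exists>m. infinite (L m)")
    \<comment> \<open>All \<open>L n\<close> are finite, so \<open>lambda\<close> is countable and
      the binary tree already has \<open>2\<close> to the \<open>lambda\<close> branches.\<close>
    case False
    then have fin: "finite (L n)" for n by blast
    show ?thesis
    proof (rule many_traces[of lambda "\<lambda>_. UNIV :: bool set"])
      show "|UNIV :: bool set| \<le>o lambda"
        using inf_lam assms(4) by (metis ctwo_def ctwo_ordLeq_Cinfinite cinfinite_def)
      have "|SIGMA n:UNIV. L n| \<le>o |UNIV :: nat set|"
      proof (rule card_of_Sigma_ordLeq_infinite)
        have "|L n| \<le>o |UNIV :: nat set|" for n
          using countable_finite[OF fin] unfolding countable_def card_of_ordLeq[symmetric] by blast
        then show "\<forall>n\<in>UNIV. |L n| \<le>o |UNIV :: nat set|" by blast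
      qed (auto simp: card_of_mono1)
      then have "|Pow (SIGMA n:UNIV. L n)| \<le>o |Pow (UNIV :: nat set)|" by (rule card_of_Pow_mono)
      also have "|Pow (UNIV :: nat set)| \<le>o |Pi UNIV (\<lambda>_::nat. UNIV :: bool set)|"
        unfolding card_of_ordLeq[symmetric] by (intro exI[of _ "\<lambda>A n. n \<in> A"]) (auto simp: inj_on_def fun_eq_iff)
      finally show "|Pow (Field lambda)| \<le>o |Pi UNIV (\<lambda>_::nat. UNIV :: bool set)|"
        by (rule ordLeq_transitive[OF lamSP])
      show "splits (UNIV :: bool set) Y V" if "openin Omega V" "big (extensions Y V)" for Y V
        using that by (rule splits_two)
      show "big {U. openin Omega U}" using bigT by (simp add: small_def)
    qed (use assms(4) inf_lam limit in auto)
  next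
    case True
    then obtain m where m: "infinite (L m)" by blast
    have MM: "|L n| \<le>o |M (Suc n)|" for n unfolding L_def M_def by (rule card_of_mono2[OF assms(8)])
    \<comment> \<open>The shift by \<open>m\<close> makes \<open>M (N n)\<close> infinite. One
      successor absorbs a power set, \<open>|Pow (L n)| <= |L (Suc n)|\<close>, the other is that of
      \<open>|L n| <= |M (Suc n)|\<close>. So \<open>M (N n)\<close> has at least \<open>2\<close>
      to the \<open>|L n|\<close> elements, and the product reaches \<open>2\<close> to the
      \<open>lambda\<close>.\<close>
    define N where "N n = Suc (Suc (m + n))" for n
    have LK: "|L (Suc (m + n))| \<le>o |M (N n)|" for n unfolding N_def by (rule MM)
    \<comment> \<open>This is the gap between the number of pieces and the height of the tree that
      splitting into infinitely many families requires.\<close>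
    have beth: "|Pow (Pow (M n))| <o |L n|" for n
    proof -
      define s where "s = ctwo ^c (ctwo ^c mus n)"
      have "|Pow (M n)| \<le>o |Field (ctwo ^c mus n)|"
        unfolding M_def cexp_def[of ctwo] Field_card_of using ctwo_cexp_Pow[of "mus n"]
        by (simp add: cexp_def ordIso_iff_ordLeq)
      then have "|Pow (Pow (M n))| \<le>o |Pow (Field (ctwo ^c mus n))|" by (rule card_of_Pow_mono)
      then have "|Pow (Pow (M n))| \<le>o s"
        unfolding s_def by (rule ordLeq_ordIso_trans[OF _ ordIso_symmetric[OF ctwo_cexp_Pow]])
      moreover have "s <o beth3 (mus n)"
        unfolding s_def beth3_def by (rule ordLess_ctwo_cexp[OF Card_order_cexp])
      ultimately have "|Pow (Pow (M n))| <o lambdas n"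
        using assms(9) ordLeq_ordLess_trans ordLess_transitive by blast
      then show ?thesis by (rule ordLess_ordIso_trans[OF _ ordIso_symmetric[OF L]])
    qed
    show ?thesis
    proof (rule many_traces[of lambda "\<lambda>n. M (N n)"])
      show "|M (N n)| \<le>o lambda" for n by (rule Mlam)
      have "|Pow (L n)| \<le>o |M (N n)|" for n
        using ordLeq_transitive[OF ordLeq_transitive[OF PowLL Lmono] LK, of n n] by simp
      then have "|Pow (SIGMA n:UNIV. L n)| \<le>o |Pi UNIV (\<lambda>n. M (N n))|" by (rule Pow_Sigma_ordLeq_Pi)
      then show "|Pow (Field lambda)| \<le>o |Pi UNIV (\<lambda>n. M (N n))|" by (rule ordLeq_transitive[OF lamSP])
      show "splits (M (N n)) Y V" if V: "openin Omega V" "big (extensions Y V)" for n Y V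
      proof -
        obtain Bs where Bs: "small Bs"
          "\<And>W a. openin Omega W \<Longrightarrow> a \<subseteq> W \<Longrightarrow> |a| \<le>o lambdas (N n) \<Longrightarrow>
            \<exists>G. (\<forall>i\<in>Field (mus (N n)). G i \<in> Bs \<and> openin Omega (G i) \<and> G i \<subseteq> W) \<and> a \<subseteq> (\<Union>i\<in>Field (mus (N n)). G i)"
          by (rule cover_by_small_family[OF assms(1) smallL[unfolded L_def] assms(6) assms(13)[of "N n"]]) blast
        have "infinite (L (Suc (m + n)))" using card_of_ordLeq_infinite[OF Lmono m] by simp
        then have "infinite (M (N n))" using card_of_ordLeq_infinite[OF LK] by blast
        then show ?thesis
        proof (rule splits_infinite[OF V _ beth smallL Bs(1)])
          fix W a assume "openin Omega W" "a \<subseteq> W" "|a| \<le>o |L (N n)|"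
          then show "\<exists>G. (\<forall>i\<in>M (N n). G i \<in> Bs \<and> openin Omega (G i) \<and> G i \<subseteq> W) \<and> a \<subseteq> (\<Union>i\<in>M (N n). G i)"
            using Bs(2)[of W a] ordLeq_ordIso_trans[OF _ L] unfolding M_def by blast
        qed
      qed
      show "big {U. openin Omega U}" using bigT by (simp add: small_def)
    qed (use assms(4) inf_lam limit in auto)
  qed
  have many: "lambda ^c natLeq \<le>o |{U. openin Omega U}|" if bigT: "\<not> |{U. openin Omega U}| \<le>o mu"
  proof -
    obtain X0 where "|{U \<inter> X0 | U. openin Omega U}| =o ctwo ^c lambda" using traces[OF bigT] by blast
    then have "ctwo ^c lambda \<le>o |{U \<inter> X0 | U. openin Omega U}|" by (rule ordIso_imp_ordLeq[OF ordIso_symmetric])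
    also have "{U \<inter> X0 | U. openin Omega U} = (\<lambda>U. U \<inter> X0) ` {U. openin Omega U}" by blast
    also have "|(\<lambda>U. U \<inter> X0) ` {U. openin Omega U}| \<le>o |{U. openin Omega U}|" by (rule card_of_image)
    finally show ?thesis by (rule ordIso_ordLeq_trans[OF power])
  qed
  show ?thesis
  proof (intro conjI impI)
    show "lambda ^c natLeq =o ctwo ^c lambda" by (rule power)
    show "lambda ^c natLeq \<le>o |{U. openin Omega U}| \<or> |{U. openin Omega U}| \<le>o mu" using many by blast
    assume "mu <o |{U. openin Omega U}|"
    then show "\<exists>X0. X0 \<subseteq> topspace Omega \<and> |X0| =o lambda
          \<and> |{U \<inter> X0 | U. openin Omega U}| =o ctwo ^c lambda
          \<and> (\<exists>B'. B' \<subseteq> {U. openin Omega U} \<and> |B'| =o lambda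
                \<and> |{X0 \<inter> U | U. \<exists>F\<subseteq>B'. U = \<Union>F}| =o ctwo ^c lambda)"
      by (rule traces[OF not_ordLess_ordLeq])
  qed
qed

end
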